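(* Let $G$ be a locally compact group, $\{\pi,\mathcal H_\pi\}$ a unitary representation of $G$, $\eta$ an admissible vector for $\{\pi,\mathcal H_\pi\}$ and $g_\eta=L_\eta\eta=(\eta|\pi(\cdot)\eta)$. Let $\xi\in\mathcal H_\pi$ and put $\xi_\eta:=L_\eta\xi=(\xi|\pi(\cdot)\eta)$. Then: (i) $\xi$ is an admissible vector for $\{\pi,\mathcal H_\pi\}$ if and only if $\xi_\eta\in\mathcal D^\flat$ and $g_\eta=\xi_\eta^\flat\ast\xi_\eta$. (ii) If $\xi$ is an admissible vector for $\{\pi,\mathcal H_\pi\}$ and $\xi_\eta^\flat=\xi_\eta$, then $(\eta|\pi(\cdot)\eta)=(\xi|\pi(\cdot)\xi)$ and $L_\xi\mathcal H_\pi=L_\eta\mathcal H_\pi$.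
   Context: $G$ is a locally compact group with fixed left Haar measure $ds$ and modular function $\delta_G$ (so $d(st)=\delta_G(t)\,ds$, $d(s^{-1})=\delta_G(s^{-1})\,ds$); $L^2(G)$ is taken with respect to $ds$. A unitary representation $\{\pi,\mathcal H_\pi\}$ is a strongly continuous homomorphism from $G$ into the unitary operators of a nonzero Hilbert space $\mathcal H_\pi$, with inner product $(\cdot|\cdot)$ linear in the first variable. For $\eta,\psi\in\mathcal H_\pi$, $[L_\eta\psi](s):=(\psi|\pi(s)\eta)$, $s\in G$. The vector $\eta$ is admissible if $L_\eta$ is a bounded map $\mathcal H_\pi\to L^2(G)$ with $L_\eta^*L_\eta=I_{\mathcal H_\pi}$. Convolution: $[f\ast g](s):=\int_G f(t)g(t^{-1}s)\,dt$. Involution: $f^\flat(s):=\overline{f(s^{-1})}$, with domain $\mathcal D^\flat:=\{f\in L^2(G):\int_G\delta_G^{-1}(s)|f(s)|^2\,ds<\infty\}$. *)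

theory Defs
  imports "HOL-Analysis.Analysis"
begin

section \<open>Complex Hilbert spaces\<close>

text \<open>The inner product is linear in the first variable.\<close>

class complex_inner = real_normed_vector +
  fixes scaleC :: "complex \<Rightarrow> 'a \<Rightarrow> 'a"  (infixr "*\<^sub>C" 75)
    and cinner :: "'a \<Rightarrow> 'a \<Rightarrow> complex"
  assumes scaleC_add_right: "a *\<^sub>C (x + y) = a *\<^sub>C x + a *\<^sub>C y"
    and scaleC_add_left: "(a + b) *\<^sub>C x = a *\<^sub>C x + b *\<^sub>C x"
    and scaleC_scaleC: "a *\<^sub>C (b *\<^sub>C x) = (a * b) *\<^sub>C x"
    and scaleR_scaleC: "r *\<^sub>R x = complex_of_real r *\<^sub>C x"
    and cinner_commute: "cinner x y = cnj (cinner y x)"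
    and cinner_add_left: "cinner (x + y) z = cinner x z + cinner y z"
    and cinner_scaleC_left: "cinner (a *\<^sub>C x) y = a * cinner x y"
    and cinner_ge_zero: "0 \<le> Re (cinner x x)"
    and cinner_eq_zero_iff: "cinner x x = 0 \<longleftrightarrow> x = 0"
    and norm_eq_sqrt_cinner: "norm x = sqrt (Re (cinner x x))"

class chilbert_space = complex_inner + complete_space

instantiation complex :: chilbert_space
begin

definition scaleC_complex :: "complex \<Rightarrow> complex \<Rightarrow> complex" where
  "scaleC_complex a x = a * x"

definition cinner_complex :: "complex \<Rightarrow> complex \<Rightarrow> complex" where
  "cinner_complex x y = x * cnj y"

instance
  by standard
    (auto simp: scaleC_complex_def cinner_complex_def algebra_simps scaleR_conv_of_real
      cmod_def power2_eq_square)

end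


section \<open>Haar measure and modular function\<close>

text \<open>
  Groups are types of class \<^class>\<open>topological_group_add\<close>. The class
  \<^class>\<open>group_add\<close> does not include commutativity, so that \<open>s + t\<close> stands for the product
  \<open>st\<close> of a possibly non-abelian group, \<open>- s\<close> for the inverse of \<open>s\<close>, and \<open>0\<close> for the
  neutral element.

  A left Haar measure is a nonzero left invariant Radon measure on the Borel sets; it is
  not required to be sigma-finite.
\<close>

definition radon_measure :: "'a::t2_space measure \<Rightarrow> bool" where
  "radon_measure \<mu> \<longleftrightarrow>
     sets \<mu> = sets borel \<and>
     (\<forall>K. compact K \<longrightarrow> emeasure \<mu> K < \<infinity>) \<and>
     (\<forall>A\<in>sets borel. emeasure \<mu> A = (INF U\<in>{U. open U \<and> A \<subseteq> U}. emeasure \<mu> U)) \<and>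
     (\<forall>U. open U \<longrightarrow>
        emeasure \<mu> U = (SUP K\<in>{K. compact K \<and> K \<subseteq> U}. emeasure \<mu> K))"

definition left_haar_measure :: "'g::{topological_group_add, t2_space} measure \<Rightarrow> bool" where
  "left_haar_measure \<mu> \<longleftrightarrow>
     radon_measure \<mu> \<and>
     emeasure \<mu> UNIV \<noteq> 0 \<and>
     (\<forall>t. \<forall>A\<in>sets borel. emeasure \<mu> ((\<lambda>s. t + s) ` A) = emeasure \<mu> A)"

text \<open>The convention \<open>d(st) = \<delta>(t) ds\<close>, i.e. \<open>\<mu>(At) = \<delta>(t) \<mu>(A)\<close>.\<close>

definition modular_function ::
    "'g::{topological_group_add, t2_space} measure \<Rightarrow> ('g \<Rightarrow> real) \<Rightarrow> bool" where
  "modular_function \<mu> \<delta> \<longleftrightarrow>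
     (\<forall>t. 0 < \<delta> t) \<and>
     (\<forall>t. \<forall>A\<in>sets borel. emeasure \<mu> ((\<lambda>s. s + t) ` A) = ennreal (\<delta> t) * emeasure \<mu> A)"


section \<open>Square-integrable functions\<close>

text \<open>Elements of \<open>L\<^sup>2\<close> are represented by functions rather than by classes modulo null sets.\<close>

definition L2 :: "'g measure \<Rightarrow> ('g \<Rightarrow> complex) set" where
  "L2 \<mu> = {f \<in> borel_measurable \<mu>. integrable \<mu> (\<lambda>s. (cmod (f s))\<^sup>2)}"

definition L2_inner :: "'g measure \<Rightarrow> ('g \<Rightarrow> complex) \<Rightarrow> ('g \<Rightarrow> complex) \<Rightarrow> complex" where
  "L2_inner \<mu> f g = (\<integral>s. f s * cnj (g s) \<partial>\<mu>)"

definition L2_norm :: "'g measure \<Rightarrow> ('g \<Rightarrow> complex) \<Rightarrow> real" where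
  "L2_norm \<mu> f = sqrt (\<integral>s. (cmod (f s))\<^sup>2 \<partial>\<mu>)"

definition bounded_into_L2 ::
    "'g measure \<Rightarrow> ('h::chilbert_space \<Rightarrow> 'g \<Rightarrow> complex) \<Rightarrow> bool" where
  "bounded_into_L2 \<mu> T \<longleftrightarrow>
     (\<forall>\<psi>. T \<psi> \<in> L2 \<mu>) \<and> (\<exists>C. \<forall>\<psi>. L2_norm \<mu> (T \<psi>) \<le> C * norm \<psi>)"

text \<open>\<open>S\<close> is the Hilbert space adjoint of \<open>T\<close>; it is uniquely determined on \<open>L2 \<mu>\<close>.\<close>

definition is_L2_adjoint ::
    "'g measure \<Rightarrow> ('h::chilbert_space \<Rightarrow> 'g \<Rightarrow> complex) \<Rightarrow> (('g \<Rightarrow> complex) \<Rightarrow> 'h) \<Rightarrow> bool" where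
  "is_L2_adjoint \<mu> T S \<longleftrightarrow>
     (\<forall>f\<in>L2 \<mu>. \<forall>\<psi>. cinner (S f) \<psi> = L2_inner \<mu> f (T \<psi>))"

definition convolution ::
    "'g::group_add measure \<Rightarrow> ('g \<Rightarrow> complex) \<Rightarrow> ('g \<Rightarrow> complex) \<Rightarrow> 'g \<Rightarrow> complex" where
  "convolution \<mu> f g = (\<lambda>s. \<integral>t. f t * g (- t + s) \<partial>\<mu>)"

definition flat :: "('g::group_add \<Rightarrow> complex) \<Rightarrow> 'g \<Rightarrow> complex" where
  "flat f = (\<lambda>s. cnj (f (- s)))"

definition flat_domain :: "'g::group_add measure \<Rightarrow> ('g \<Rightarrow> real) \<Rightarrow> ('g \<Rightarrow> complex) set" where
  "flat_domain \<mu> \<delta> =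
     {f \<in> L2 \<mu>. (\<integral>\<^sup>+ s. ennreal (inverse (\<delta> s) * (cmod (f s))\<^sup>2) \<partial>\<mu>) < \<infinity>}"


section \<open>Unitary representations and admissible vectors\<close>

definition unitary_operator :: "('h::chilbert_space \<Rightarrow> 'h) \<Rightarrow> bool" where
  "unitary_operator U \<longleftrightarrow>
     (\<forall>x y. U (x + y) = U x + U y) \<and>
     (\<forall>c x. U (c *\<^sub>C x) = c *\<^sub>C U x) \<and>
     (\<forall>x y. cinner (U x) (U y) = cinner x y) \<and>
     surj U"

definition unitary_representation ::
    "('g::topological_group_add \<Rightarrow> 'h::chilbert_space \<Rightarrow> 'h) \<Rightarrow> bool" where
  "unitary_representation \<pi> \<longleftrightarrow>
     (\<exists>x::'h. x \<noteq> 0) \<and>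
     (\<forall>s. unitary_operator (\<pi> s)) \<and>
     (\<forall>s t. \<pi> (s + t) = \<pi> s \<circ> \<pi> t) \<and>
     (\<forall>x. continuous_on UNIV (\<lambda>s. \<pi> s x))"

definition coeff_op ::
    "('g \<Rightarrow> 'h::chilbert_space \<Rightarrow> 'h) \<Rightarrow> 'h \<Rightarrow> 'h \<Rightarrow> 'g \<Rightarrow> complex" where
  "coeff_op \<pi> \<eta> \<psi> = (\<lambda>s. cinner \<psi> (\<pi> s \<eta>))"

definition admissible ::
    "'g measure \<Rightarrow> ('g \<Rightarrow> 'h::chilbert_space \<Rightarrow> 'h) \<Rightarrow> 'h \<Rightarrow> bool" where
  "admissible \<mu> \<pi> \<eta> \<longleftrightarrow>
     bounded_into_L2 \<mu> (coeff_op \<pi> \<eta>) \<and>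
     (\<exists>S. is_L2_adjoint \<mu> (coeff_op \<pi> \<eta>) S \<and> S \<circ> coeff_op \<pi> \<eta> = id)"

end

theory Submission
  imports Defs
begin

text \<open>Write \<open>L\<^sub>\<xi> \<psi>\<close> for \<open>coeff_op \<pi> \<xi> \<psi>\<close>. A vector is admissible iff \<open>L\<close> is isometric, and
  \<open>\<xi>\<^sub>\<eta>\<^sup>\<flat> = L\<^sub>\<xi> \<eta>\<close>. Hence, by the inversion formula \<open>d(s\<^sup>-\<^sup>1) = \<delta>(s\<^sup>-\<^sup>1) ds\<close>, \<open>\<xi>\<^sub>\<eta>\<close> is in the domain of the involution
  iff \<open>L\<^sub>\<xi> \<eta>\<close> is square-integrable, while \<open>\<xi>\<^sub>\<eta>\<^sup>\<flat> \<star> \<xi>\<^sub>\<eta>\<close> is \<open>u \<mapsto> \<langle>L\<^sub>\<xi> \<eta>, L\<^sub>\<xi> \<pi>(u)\<eta>\<rangle>\<close>. So the right-hand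
  side of (i) says that \<open>L\<^sub>\<xi>\<close> preserves inner products on the orbit of \<open>\<eta>\<close>. The orbit spans a dense subspace
  because \<open>L\<^sub>\<eta>\<close> is injective, and Fatou's lemma and the parallelogram law extend the isometry to the
  whole space. For (ii), \<open>L\<^sub>\<xi> \<eta> = L\<^sub>\<eta> \<xi>\<close> implies \<open>L\<^sub>\<xi> \<pi>(s)\<eta> = L\<^sub>\<eta> \<pi>(s)\<xi>\<close>, and both claims follow
  by isometry and density.\<close>

section \<open>Iterated integrals of continuous functions with compact support\<close>

text \<open>Locally compact Hausdorff spaces are completely regular. Separating \<open>K\<close>
  from the complement of \<open>U \<inter> W\<close>, where \<open>W\<close> is a neighbourhood of
  \<open>K\<close> inside a compact \<open>L\<close>, makes the cutoff vanish off \<open>U\<close>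
  and off \<open>L\<close> at once.\<close>

lemma urysohn_compact_support:
  fixes K U :: "'a::t2_space set"
  assumes lc: "locally_compact_space (euclidean :: 'a topology)"
    and "compact K" "open U" "K \<subseteq> U"
  obtains f :: "'a \<Rightarrow> real" and L where "continuous_on UNIV f" "compact L"
    "\<And>x. 0 \<le> f x" "\<And>x. f x \<le> 1" "\<And>x. x \<in> K \<Longrightarrow> f x = 1"
    "\<And>x. x \<notin> L \<Longrightarrow> f x = 0" "\<And>x. x \<notin> U \<Longrightarrow> f x = 0"
proof -
  have haus: "Hausdorff_space (euclidean :: 'a topology)"
    unfolding Hausdorff_space_def disjnt_def using hausdorff by fastforce
  then obtain W L where W: "open W" "compact L" "K \<subseteq> W" "W \<subseteq> L"
    using locally_compact_space_compact_closed_compact[of "euclidean :: 'a topology"] lc \<open>compact K\<close>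
    by (metis compactin_euclidean_iff open_openin)
  have cr: "completely_regular_space (euclidean :: 'a topology)"
    using locally_compact_regular_imp_completely_regular_space lc haus by blast
  have "closedin euclidean (- (U \<inter> W))" "disjnt K (- (U \<inter> W))"
    using W assms by (auto simp: disjnt_def)
  then obtain f where f: "continuous_map euclidean (subtopology euclidean {0..1::real}) f"
    "f ` (- (U \<inter> W)) \<subseteq> {0}" "f ` K \<subseteq> {1}"
    using Urysohn_completely_regular_compact_closed[OF zero_le_one cr, of K "- (U \<inter> W)"] \<open>compact K\<close>
    by (metis compactin_euclidean_iff)
  show thesis
  proof
    show "continuous_on UNIV f" "compact L"
      using f(1) W by (simp_all add: continuous_map_in_subtopology)
    show "0 \<le> f x" "f x \<le> 1" for x
      using f(1) by (auto simp: continuous_map_in_subtopology Pi_iff)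
    show "f x = 1" if "x \<in> K" for x
      using f(3) that by auto
    show "f x = 0" if "x \<notin> L" for x
      using f(2) that W by auto
    show "f x = 0" if "x \<notin> U" for x
      using f(2) that by auto
  qed
qed

text \<open>The Borel sets of a product space need not be generated by rectangles. The tube lemma shows
  that continuous functions of compact support are product measurable nevertheless: in the first
  variable they are uniform limits of functions with finitely many values.\<close>

lemma borel_measurable_pair_compact_support:
  fixes F :: "'a::t2_space \<times> 'b::t2_space \<Rightarrow> real"
  assumes cont: "continuous_on UNIV F" and K: "compact K" and L: "compact L"
    and supp: "\<And>s t. F (s, t) \<noteq> 0 \<Longrightarrow> s \<in> K \<and> t \<in> L"
  shows "F \<in> borel_measurable (borel \<Otimes>\<^sub>M borel)"
proof -
  have "\<exists>x g. (g :: 'a \<Rightarrow> nat) \<in> measurable borel (count_space UNIV) \<and>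
      (\<forall>s\<in>K. \<forall>t\<in>L. dist (F (s, t)) (F (x (g s), t)) \<le> inverse (real (Suc n)))" for n
  proof -
    have "\<exists>X0. open X0 \<and> x0 \<in> X0 \<and> (\<forall>x\<in>X0. \<forall>t\<in>L. dist (F (x, t)) (F (x0, t)) \<le> inverse (real (Suc n)))"
      for x0
      by (rule continuous_on_prod_compactE[of UNIV L F x0 "inverse (real (Suc n))"])
        (use continuous_on_subset[OF cont subset_UNIV] L in auto)
    then obtain W where W: "\<And>x. open (W x)" "\<And>x. x \<in> W x"
      "\<And>x s t. s \<in> W x \<Longrightarrow> t \<in> L \<Longrightarrow> dist (F (s, t)) (F (x, t)) \<le> inverse (real (Suc n))"
      by metis
    obtain C where C: "finite C" "K \<subseteq> (\<Union>c\<in>C. W c)"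
      by (rule compactE_image[OF K, of K W]) (use W(1,2) in auto)
    obtain x :: "nat \<Rightarrow> 'a" and m where x: "C = x ` {i. i < m}"
      using finite_imp_nat_seg_image_inj_on[OF C(1)] by auto
    \<comment> \<open>The first index of a tube containing \<open>s\<close> depends measurably on
      \<open>s\<close>. Outside all tubes the value of \<open>LEAST\<close> is unspecified, which is
      harmless since the estimate concerns \<open>s \<in> K\<close> only.\<close>
    define g where "g = (\<lambda>s. LEAST i. i < m \<and> s \<in> W (x i))"
    have [measurable]: "W y \<in> sets borel" for y
      using W(1) by simp
    have g: "g \<in> measurable borel (count_space UNIV)"
      unfolding g_def by measurable
    have "dist (F (s, t)) (F (x (g s), t)) \<le> inverse (real (Suc n))" if "s \<in> K" "t \<in> L" for s t
    proof -
      have "\<exists>i. i < m \<and> s \<in> W (x i)"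
        using C(2) x that by auto
      then have "s \<in> W (x (g s))"
        unfolding g_def using LeastI_ex by (metis (mono_tags, lifting))
      then show ?thesis
        using W(3) that by blast
    qed
    with g show ?thesis
      by (intro exI[of _ x] exI[of _ g]) auto
  qed
  then obtain x g where g: "\<And>n. (g n :: 'a \<Rightarrow> nat) \<in> measurable borel (count_space UNIV)"
    and xg: "\<And>n s t. s \<in> K \<Longrightarrow> t \<in> L \<Longrightarrow> dist (F (s, t)) (F (x n (g n s), t)) \<le> inverse (real (Suc n))"
    by metis
  define G where "G = (\<lambda>n (s, t). indicator K s * indicator L t * F (x n (g n s), t))"
  have [measurable]: "K \<in> sets borel" "L \<in> sets borel"
    using K L by (simp_all add: borel_closed compact_imp_closed)
  have [measurable]: "(\<lambda>t. F (c, t)) \<in> borel_measurable borel" for c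
    by (intro borel_measurable_continuous_onI continuous_on_compose2[OF cont] continuous_intros) auto
  have "G n \<in> borel_measurable (borel \<Otimes>\<^sub>M borel)" for n
  proof -
    note g[measurable]
    have "(\<lambda>p. F (x n (g n (fst p)), snd p)) \<in> borel_measurable (borel \<Otimes>\<^sub>M borel)"
      by (rule measurable_compose_countable[where f = "\<lambda>i p. F (x n i, snd p)" and g = "\<lambda>p. g n (fst p)"])
        measurable
    then show ?thesis
      unfolding G_def split_beta by measurable
  qed
  moreover have "(\<lambda>n. G n p) \<longlonglongrightarrow> F p" for p
  proof (cases "fst p \<in> K \<and> snd p \<in> L")
    case True
    then have "dist (G n p) (F p) \<le> inverse (real (Suc n))" for n
      using xg[of "fst p" "snd p" n] by (auto simp: G_def split_beta dist_commute)
    then have "(\<lambda>n. dist (G n p) (F p)) \<longlonglongrightarrow> 0"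
      by (intro tendsto_sandwich[OF _ _ tendsto_const LIMSEQ_inverse_real_of_nat]) auto
    then show ?thesis
      by (simp add: tendsto_dist_iff[symmetric])
  next
    case False
    then have "F p = 0"
      using supp[of "fst p" "snd p"] by force
    with False have "G n p = F p" for n
      by (auto simp: G_def split_beta)
    then show ?thesis
      by simp
  qed
  ultimately show ?thesis
    by (rule borel_measurable_LIMSEQ_real[rotated])
qed

text \<open>Haar measure need not be sigma-finite, so Fubini's theorem does not apply to it
  directly. Restricting both measures to the compact sets carrying \<open>F\<close> makes them
  finite and changes none of the integrals.\<close>

lemma nn_integral_swap_compact_support:
  fixes F :: "'a::t2_space \<Rightarrow> 'b::t2_space \<Rightarrow> real"
  assumes sets: "sets \<mu> = sets borel" "sets \<nu> = sets borel"
    and fin: "\<And>K. compact K \<Longrightarrow> emeasure \<mu> K < \<infinity>" "\<And>L. compact L \<Longrightarrow> emeasure \<nu> L < \<infinity>"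
    and cont: "continuous_on UNIV (\<lambda>p. F (fst p) (snd p))" and K: "compact K" and L: "compact L"
    and supp: "\<And>s t. F s t \<noteq> 0 \<Longrightarrow> s \<in> K \<and> t \<in> L"
  shows "(\<integral>\<^sup>+ s. \<integral>\<^sup>+ t. ennreal (F s t) \<partial>\<nu> \<partial>\<mu>) = (\<integral>\<^sup>+ t. \<integral>\<^sup>+ s. ennreal (F s t) \<partial>\<mu> \<partial>\<nu>)"
proof -
  define MK where "MK = density \<mu> (indicator K)"
  define NL where "NL = density \<nu> (indicator L)"
  have [measurable_cong]: "sets \<mu> = sets borel" "sets \<nu> = sets borel" "sets MK = sets borel" "sets NL = sets borel"
    using sets by (simp_all add: MK_def NL_def)
  have [measurable]: "K \<in> sets borel" "L \<in> sets borel"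
    using K L by (simp_all add: borel_closed compact_imp_closed)
  have [measurable]: "(\<lambda>p. F (fst p) (snd p)) \<in> borel_measurable (borel \<Otimes>\<^sub>M borel)"
    by (rule borel_measurable_pair_compact_support[OF cont K L]) (use supp in auto)
  have "finite_measure MK" "finite_measure NL"
    using fin(1)[OF K] fin(2)[OF L]
    by (auto intro!: finite_measureI simp: MK_def NL_def emeasure_density
        sets_eq_imp_space_eq[OF sets(1)] sets_eq_imp_space_eq[OF sets(2)])
  then interpret MK: finite_measure MK + NL: finite_measure NL .
  interpret P: pair_sigma_finite MK NL ..
  have F1: "(\<lambda>p. ennreal (F (fst p) (snd p))) \<in> borel_measurable (MK \<Otimes>\<^sub>M NL)"
    by measurable
  have [measurable]: "F s \<in> borel_measurable borel" "(\<lambda>s. F s t) \<in> borel_measurable borel" for s t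
    by (intro borel_measurable_continuous_onI continuous_on_compose2[OF cont, of _ "Pair s", simplified]
        continuous_on_compose2[OF cont, of _ "\<lambda>s. (s, t)", simplified] continuous_intros)+
  have [measurable]: "(\<lambda>p. F (snd p) (fst p)) \<in> borel_measurable (borel \<Otimes>\<^sub>M borel)"
    using measurable_compose[OF measurable_Pair[OF measurable_snd measurable_fst]
        borel_measurable_pair_compact_support[OF cont K L]] supp by auto
  have vanish: "F s t = 0" if "s \<notin> K \<or> t \<notin> L" for s t
    using supp that by blast
  have 1: "(\<integral>\<^sup>+ t. ennreal (F s t) \<partial>NL) = (\<integral>\<^sup>+ t. ennreal (F s t) \<partial>\<nu>)" for s
    unfolding NL_def
    by (subst nn_integral_density) (auto intro!: nn_integral_cong simp: indicator_def vanish)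
  have 2: "(\<integral>\<^sup>+ s. ennreal (F s t) \<partial>MK) = (\<integral>\<^sup>+ s. ennreal (F s t) \<partial>\<mu>)" for t
    unfolding MK_def
    by (subst nn_integral_density) (auto intro!: nn_integral_cong simp: indicator_def vanish)
  have "(\<integral>\<^sup>+ s. \<integral>\<^sup>+ t. ennreal (F s t) \<partial>NL \<partial>MK) = (\<integral>\<^sup>+ s. \<integral>\<^sup>+ t. ennreal (F s t) \<partial>NL \<partial>\<mu>)"
    unfolding MK_def
    by (subst nn_integral_density)
      (auto intro!: nn_integral_cong simp: indicator_def vanish)
  moreover have "(\<integral>\<^sup>+ t. \<integral>\<^sup>+ s. ennreal (F s t) \<partial>MK \<partial>NL) = (\<integral>\<^sup>+ t. \<integral>\<^sup>+ s. ennreal (F s t) \<partial>MK \<partial>\<nu>)"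
    unfolding NL_def
    by (subst nn_integral_density)
      (auto intro!: nn_integral_cong simp: indicator_def vanish)
  moreover have "(\<integral>\<^sup>+ s. \<integral>\<^sup>+ t. ennreal (F s t) \<partial>NL \<partial>MK) = (\<integral>\<^sup>+ t. \<integral>\<^sup>+ s. ennreal (F s t) \<partial>MK \<partial>NL)"
    using P.Fubini[OF F1] by simp
  ultimately show ?thesis
    by (simp add: 1 2)
qed

section \<open>Haar measure, modular function and inversion\<close>

lemma card_below_le:
  assumes "0 \<le> y"
  shows "real (card {k\<in>{1..N}. real k < y}) \<le> y"
proof -
  have "{k\<in>{1..N}. real k < y} \<subseteq> {1..nat \<lfloor>y\<rfloor>}"
    by (auto simp: le_nat_iff le_floor_iff)
  from card_mono[OF finite_atLeastAtMost this] have "card {k\<in>{1..N}. real k < y} \<le> nat \<lfloor>y\<rfloor>"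
    by simp
  also have "real (nat \<lfloor>y\<rfloor>) \<le> y"
    using assms by simp
  finally show ?thesis
    by simp
qed

text \<open>Counting the positive integers below \<open>y\<close> recovers \<open>y\<close> up to an
  error of one, provided that the cutoff \<open>N\<close> loses none of them. In
  \<open>nn_integral_mono_open\<close> this error is divided by \<open>Suc n\<close>.\<close>

lemma card_below_ge:
  assumes "y \<le> real N"
  shows "y - 1 \<le> real (card {k\<in>{1..N}. real k < y})"
proof -
  have "{1..<nat \<lceil>y\<rceil>} \<subseteq> {k\<in>{1..N}. real k < y}"
    using assms by (auto simp: less_ceiling_iff zless_nat_eq_int_zless less_imp_le)
  then have "card {1..<nat \<lceil>y\<rceil>} \<le> card {k\<in>{1..N}. real k < y}"
    by (intro card_mono) auto
  moreover have "y - 1 \<le> real (nat \<lceil>y\<rceil> - 1)"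
    by linarith
  ultimately show ?thesis
    by simp
qed

lemma ennreal_card_eq_sum_indicator:
  assumes "finite A" "0 \<le> c"
  shows "ennreal (c * real (card {k\<in>A. x \<in> E k})) = (\<Sum>k\<in>A. ennreal c * indicator (E k) x)"
proof -
  have "real (card {k\<in>A. x \<in> E k}) = (\<Sum>k\<in>A. indicator (E k) x)"
    using assms(1) by (simp add: indicator_def sum_of_bool_eq Int_def)
  then have "c * real (card {k\<in>A. x \<in> E k}) = (\<Sum>k\<in>A. c * indicator (E k) x)"
    by (simp add: sum_distrib_left)
  then show ?thesis
    using assms(2) by (simp add: ennreal_mult ennreal_indicator flip: sum_ennreal)
qed

text \<open>\<open>h\<close> is the limit of the normalized sums of the indicators of its level sets
  \<open>{k < n h}\<close>, \<open>1 \<le> k \<le> n\<^sup>2\<close>. Using these instead of the layer cake formula avoids any assumption of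
  sigma-finiteness.\<close>

lemma nn_integral_mono_open:
  fixes h :: "'a::topological_space \<Rightarrow> real"
  assumes sets: "sets M = sets borel" "sets N = sets borel"
    and le: "\<And>U. open U \<Longrightarrow> emeasure M U \<le> emeasure N U"
    and h: "continuous_on UNIV h" "\<And>x. 0 \<le> h x"
  shows "(\<integral>\<^sup>+ x. ennreal (h x) \<partial>M) \<le> (\<integral>\<^sup>+ x. ennreal (h x) \<partial>N)"
proof -
  \<comment> \<open>\<open>Suc n ^ 2\<close> steps of height \<open>1 / Suc n\<close> reach up to
    \<open>Suc n\<close>, so truncation is felt only where \<open>h x > Suc n\<close>. The strict
    inequality makes the level sets open, as the comparison \<open>le\<close> requires.\<close>
  define E where "E = (\<lambda>n k. {x. real k < real (Suc n) * h x})"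
  define r where "r = (\<lambda>n x. real (card {k\<in>{1..Suc n ^ 2}. x \<in> E n k}) / real (Suc n))"
  have E_open: "open (E n k)" for n k
    unfolding E_def by (intro open_Collect_less continuous_intros h)
  have [measurable_cong]: "sets M = sets borel" "sets N = sets borel"
    by (fact sets)+
  have [measurable]: "E n k \<in> sets borel" for n k
    using E_open by simp
  have r_sum: "ennreal (r n x) = (\<Sum>k\<in>{1..Suc n ^ 2}. ennreal (inverse (real (Suc n))) * indicator (E n k) x)"
    for n x
    unfolding r_def by (subst ennreal_card_eq_sum_indicator[symmetric]) (simp_all add: divide_inverse mult.commute)
  have r_meas [measurable]: "(\<lambda>x. ennreal (r n x)) \<in> borel_measurable borel" for n
    unfolding r_sum by measurable
  have r_le: "r n x \<le> h x" for n x
    using card_below_le[of "real (Suc n) * h x"] h(2)[of x]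
    by (simp add: r_def E_def divide_le_eq mult.commute)
  have r_ge: "h x - inverse (real (Suc n)) \<le> r n x" if "h x \<le> real (Suc n)" for n x
  proof -
    have "real (Suc n) * h x \<le> real (Suc n ^ 2)"
      unfolding power2_eq_square of_nat_mult by (intro mult_left_mono that) simp
    from divide_right_mono[OF card_below_ge[OF this], of "real (Suc n)"]
    have "(real (Suc n) * h x - 1) / real (Suc n) \<le> r n x"
      unfolding r_def E_def by simp
    then show ?thesis
      by (simp add: diff_divide_distrib inverse_eq_divide del: of_nat_Suc)
  qed
  have lim: "(\<lambda>n. ennreal (r n x)) \<longlonglongrightarrow> ennreal (h x)" for x
  proof (rule tendsto_ennrealI, rule tendsto_sandwich[of "\<lambda>n. h x - inverse (real (Suc n))" _ _ "\<lambda>_. h x"])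
    obtain m where "h x \<le> real m"
      using real_arch_simple by blast
    then show "\<forall>\<^sub>F n in sequentially. h x - inverse (real (Suc n)) \<le> r n x"
      by (intro eventually_sequentiallyI[of m] r_ge) linarith
    show "(\<lambda>n. h x - inverse (real (Suc n))) \<longlonglongrightarrow> h x"
      using tendsto_diff[OF tendsto_const[of "h x"] LIMSEQ_inverse_real_of_nat] by simp
  qed (simp_all add: r_le)
  have r_int: "(\<integral>\<^sup>+ x. ennreal (r n x) \<partial>L) = (\<Sum>k\<in>{1..Suc n ^ 2}. ennreal (inverse (real (Suc n))) * emeasure L (E n k))"
    if [measurable_cong]: "sets L = sets borel" for n L
  proof -
    have "(\<integral>\<^sup>+ x. ennreal (r n x) \<partial>L) =
        (\<Sum>k\<in>{1..Suc n ^ 2}. \<integral>\<^sup>+ x. ennreal (inverse (real (Suc n))) * indicator (E n k) x \<partial>L)"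
      unfolding r_sum by (rule nn_integral_sum) measurable
    also have "\<dots> = (\<Sum>k\<in>{1..Suc n ^ 2}. ennreal (inverse (real (Suc n))) * emeasure L (E n k))"
      by (intro sum.cong refl nn_integral_cmult_indicator) measurable
    finally show ?thesis .
  qed
  have "(\<integral>\<^sup>+ x. ennreal (r n x) \<partial>M) \<le> (\<integral>\<^sup>+ x. ennreal (h x) \<partial>N)" for n
  proof -
    have "(\<integral>\<^sup>+ x. ennreal (r n x) \<partial>M) = (\<Sum>k\<in>{1..Suc n ^ 2}. ennreal (inverse (real (Suc n))) * emeasure M (E n k))"
      by (rule r_int) (fact sets)
    also have "\<dots> \<le> (\<Sum>k\<in>{1..Suc n ^ 2}. ennreal (inverse (real (Suc n))) * emeasure N (E n k))"
      by (intro sum_mono mult_left_mono le E_open) auto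
    also have "\<dots> = (\<integral>\<^sup>+ x. ennreal (r n x) \<partial>N)"
      by (rule r_int[symmetric]) (fact sets)
    also have "\<dots> \<le> (\<integral>\<^sup>+ x. ennreal (h x) \<partial>N)"
      by (intro nn_integral_mono ennreal_leI r_le)
    finally show ?thesis .
  qed
  \<comment> \<open>\<open>r n\<close> need not increase with \<open>n\<close>; Fatou's lemma takes
    the place of monotone convergence.\<close>
  then have "liminf (\<lambda>n. \<integral>\<^sup>+ x. ennreal (r n x) \<partial>M) \<le> (\<integral>\<^sup>+ x. ennreal (h x) \<partial>N)"
    using Liminf_mono[of "\<lambda>n. \<integral>\<^sup>+ x. ennreal (r n x) \<partial>M" "\<lambda>_. \<integral>\<^sup>+ x. ennreal (h x) \<partial>N" sequentially]
    by (simp add: Liminf_const)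
  moreover have "(\<integral>\<^sup>+ x. ennreal (h x) \<partial>M) = (\<integral>\<^sup>+ x. liminf (\<lambda>n. ennreal (r n x)) \<partial>M)"
    by (intro nn_integral_cong lim_imp_Liminf[symmetric] lim) simp
  moreover have "\<dots> \<le> liminf (\<lambda>n. \<integral>\<^sup>+ x. ennreal (r n x) \<partial>M)"
    by (intro nn_integral_liminf) measurable
  ultimately show ?thesis
    by simp
qed

locale haar_group =
  fixes \<mu> :: "'g::{topological_group_add, t2_space} measure"
    and \<delta> :: "'g \<Rightarrow> real"
  assumes lc: "locally_compact_space (euclidean :: 'g topology)"
    and haar: "left_haar_measure \<mu>"
    and modular: "modular_function \<mu> \<delta>"
begin

lemma sets_haar [measurable_cong, simp]: "sets \<mu> = sets borel"
  and finite_on_compact: "compact K \<Longrightarrow> emeasure \<mu> K < \<infinity>"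
  and outer_regular: "A \<in> sets borel \<Longrightarrow> emeasure \<mu> A = (INF U\<in>{U. open U \<and> A \<subseteq> U}. emeasure \<mu> U)"
  and inner_regular: "open U \<Longrightarrow> emeasure \<mu> U = (SUP K\<in>{K. compact K \<and> K \<subseteq> U}. emeasure \<mu> K)"
  and haar_nonzero: "emeasure \<mu> UNIV \<noteq> 0"
  and emeasure_left: "A \<in> sets borel \<Longrightarrow> emeasure \<mu> ((\<lambda>s. t + s) ` A) = emeasure \<mu> A"
proof -
  note * = haar[unfolded left_haar_measure_def radon_measure_def]
  show "sets \<mu> = sets borel"
    using * by (elim conjE)
  show "emeasure \<mu> UNIV \<noteq> 0"
    using * by (elim conjE)
  show "compact K \<Longrightarrow> emeasure \<mu> K < \<infinity>"
    using * by (elim conjE) (erule allE, erule mp)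
  show "A \<in> sets borel \<Longrightarrow> emeasure \<mu> A = (INF U\<in>{U. open U \<and> A \<subseteq> U}. emeasure \<mu> U)"
    using * by (elim conjE) (erule bspec)
  show "open U \<Longrightarrow> emeasure \<mu> U = (SUP K\<in>{K. compact K \<and> K \<subseteq> U}. emeasure \<mu> K)"
    using * by (elim conjE) (erule allE, erule mp)
  show "A \<in> sets borel \<Longrightarrow> emeasure \<mu> ((\<lambda>s. t + s) ` A) = emeasure \<mu> A"
    using * by (elim conjE) (erule allE, erule bspec)
qed

lemma space_haar [simp]: "space \<mu> = UNIV"
  using sets_eq_imp_space_eq[OF sets_haar] by simp

lemma delta_pos [simp]: "0 < \<delta> t"
  and emeasure_right: "A \<in> sets borel \<Longrightarrow> emeasure \<mu> ((\<lambda>s. s + t) ` A) = ennreal (\<delta> t) * emeasure \<mu> A"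
  using modular unfolding modular_function_def by blast+

section \<open>Translation formulas for Haar integrals\<close>

lemma measurable_translations [measurable]:
  "(\<lambda>s. a + s) \<in> borel_measurable (borel :: 'g measure)"
  "(\<lambda>s. s + a) \<in> borel_measurable (borel :: 'g measure)"
  "(\<lambda>s. - s) \<in> borel_measurable (borel :: 'g measure)"
  by (intro borel_measurable_continuous_onI continuous_intros)+

lemma distr_left: "distr \<mu> borel (\<lambda>s. a + s) = \<mu>"
proof (rule measure_eqI)
  fix A assume "A \<in> sets (distr \<mu> borel ((+) a))"
  then have A [measurable]: "A \<in> sets borel"
    by simp
  have "(\<lambda>s. a + s) -` A = (\<lambda>s. - a + s) ` A"
    by (auto simp: add.assoc[symmetric] intro!: image_eqI[where x = "a + _"])
  then show "emeasure (distr \<mu> borel ((+) a)) A = emeasure \<mu> A"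
    by (simp add: emeasure_distr emeasure_left)
qed simp

text \<open>The preimage of \<open>A\<close> under right translation by \<open>a\<close> is
  \<open>A\<close> translated by \<open>- a\<close>; hence the factor is
  \<open>\<delta> (- a)\<close>, not \<open>\<delta> a\<close>.\<close>

lemma distr_right: "distr \<mu> borel (\<lambda>s. s + a) = scale_measure (ennreal (\<delta> (- a))) \<mu>"
proof (rule measure_eqI)
  fix A assume "A \<in> sets (distr \<mu> borel (\<lambda>s. s + a))"
  then have A [measurable]: "A \<in> sets borel"
    by simp
  have "(\<lambda>s. s + a) -` A = (\<lambda>s. s + - a) ` A"
    by (auto simp: add.assoc intro!: image_eqI[where x = "_ + a"])
  then show "emeasure (distr \<mu> borel (\<lambda>s. s + a)) A = emeasure (scale_measure (ennreal (\<delta> (- a))) \<mu>) A"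
    using emeasure_right[OF A, of "- a"] by (simp add: emeasure_distr)
qed simp

lemma nn_integral_left:
  assumes [measurable]: "f \<in> borel_measurable borel"
  shows "(\<integral>\<^sup>+ s. f (a + s) \<partial>\<mu>) = (\<integral>\<^sup>+ s. f s \<partial>\<mu>)"
  using nn_integral_distr[of "\<lambda>s. a + s" \<mu> borel f] by (simp add: distr_left)

lemma nn_integral_right:
  assumes [measurable]: "f \<in> borel_measurable borel"
  shows "(\<integral>\<^sup>+ s. f (s + a) \<partial>\<mu>) = ennreal (\<delta> (- a)) * (\<integral>\<^sup>+ s. f s \<partial>\<mu>)"
  using nn_integral_distr[of "\<lambda>s. s + a" \<mu> borel f] by (simp add: distr_right nn_integral_scale_measure)

section \<open>The modular function as a continuous homomorphism\<close>

lemma obtain_compact_pos: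
  obtains K where "compact K" "K \<in> sets borel" "0 < emeasure \<mu> K" "emeasure \<mu> K < \<infinity>"
proof -
  have "\<exists>K. compact K \<and> emeasure \<mu> K \<noteq> 0"
  proof (rule ccontr)
    assume "\<not> ?thesis"
    then have "emeasure \<mu> UNIV \<le> 0"
      unfolding inner_regular[OF open_UNIV] by (intro SUP_least) auto
    with haar_nonzero show False
      by simp
  qed
  then show thesis
    using that finite_on_compact by (auto simp: borel_closed compact_imp_closed zero_less_iff_neq_zero)
qed

text \<open>Both sides come from the same translate of a compact set whose measure is positive and
  finite and can therefore be cancelled.\<close>

lemma delta_add: "\<delta> (s + t) = \<delta> s * \<delta> t"
proof -
  obtain K where K: "compact K" "K \<in> sets borel" "0 < emeasure \<mu> K" "emeasure \<mu> K < \<infinity>"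
    by (rule obtain_compact_pos)
  have "compact ((\<lambda>x. x + s) ` K)"
    by (intro compact_continuous_image continuous_intros K)
  then have "(\<lambda>x. x + s) ` K \<in> sets borel"
    by (simp add: borel_closed compact_imp_closed)
  then have "emeasure \<mu> ((\<lambda>x. x + t) ` (\<lambda>x. x + s) ` K) = ennreal (\<delta> t) * (ennreal (\<delta> s) * emeasure \<mu> K)"
    using K by (simp add: emeasure_right)
  moreover have "(\<lambda>x. x + t) ` (\<lambda>x. x + s) ` K = (\<lambda>x. x + (s + t)) ` K"
    by (simp add: image_image add.assoc)
  ultimately have "emeasure \<mu> K * ennreal (\<delta> (s + t)) = emeasure \<mu> K * ennreal (\<delta> s * \<delta> t)"
    using emeasure_right[OF K(2), of "s + t"] by (simp add: ennreal_mult less_imp_le ac_simps)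
  then show ?thesis
    using K by (subst (asm) ennreal_mult_cancel_left) (auto simp: less_imp_le)
qed

lemma delta_zero [simp]: "\<delta> 0 = 1"
  using delta_add[of 0 0] delta_pos[of 0] by simp

lemma delta_minus: "\<delta> (- t) = inverse (\<delta> t)"
  using delta_add[of t "- t"] by (simp add: inverse_unique)

text \<open>Upper semicontinuity at the neutral element: by outer regularity some open
  \<open>U\<close> around a compact \<open>K\<close> has measure less than \<open>a\<close> times
  that of \<open>K\<close>, and by the tube lemma all small right translates of \<open>K\<close>
  stay inside \<open>U\<close>.\<close>

lemma delta_eventually_less:
  assumes "1 < a"
  shows "\<forall>\<^sub>F t in nhds 0. \<delta> t < a"
proof -
  obtain K where K: "compact K" "K \<in> sets borel" "0 < emeasure \<mu> K" "emeasure \<mu> K < \<infinity>"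
    by (rule obtain_compact_pos)
  have "emeasure \<mu> K * 1 < emeasure \<mu> K * ennreal a"
    using K assms by (intro ennreal_mult_strict_left_mono) (auto simp: one_less_ennreal)
  then have "(INF U\<in>{U. open U \<and> K \<subseteq> U}. emeasure \<mu> U) < emeasure \<mu> K * ennreal a"
    using outer_regular[OF K(2)] by simp
  then obtain U where U: "open U" "K \<subseteq> U" "emeasure \<mu> U < emeasure \<mu> K * ennreal a"
    by (auto simp: INF_less_iff)
  have "open ((\<lambda>p. snd p + fst p) -` U)"
    by (intro open_vimage U continuous_intros)
  moreover have "{0} \<times> K \<subseteq> (\<lambda>p. snd p + fst p) -` U"
    using U(2) by auto
  ultimately obtain X where X: "0 \<in> X" "open X" "X \<times> K \<subseteq> (\<lambda>p. snd p + fst p) -` U"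
    using Elementary_Topology.tube_lemma[OF K(1), of "(\<lambda>p. snd p + fst p) -` U" 0] by blast
  have "\<delta> t < a" if "t \<in> X" for t
  proof -
    have "(\<lambda>x. x + t) ` K \<subseteq> U"
      using X(3) that by auto
    then have "emeasure \<mu> ((\<lambda>x. x + t) ` K) \<le> emeasure \<mu> U"
      using U(1) by (intro emeasure_mono) auto
    then have "emeasure \<mu> K * ennreal (\<delta> t) < emeasure \<mu> K * ennreal a"
      using U(3) emeasure_right[OF K(2), of t] by (simp add: mult.commute)
    then have "ennreal (\<delta> t) < ennreal a"
      by (meson not_less mult_left_mono zero_le)
    then show ?thesis
      using assms by (simp add: ennreal_less_iff less_imp_le)
  qed
  then show ?thesis
    using X(1,2) by (auto simp: eventually_nhds)
qed

text \<open>Applying the upper bound to \<open>- t\<close> gives the lower bound at the neutral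
  element, and the homomorphism property carries continuity to every other point.\<close>

lemma delta_continuous: "continuous_on S \<delta>"
proof -
  have "(\<delta> \<longlongrightarrow> 1) (nhds 0)"
  proof (rule order_tendstoI)
    fix a :: real assume "1 < a"
    then show "\<forall>\<^sub>F t in nhds 0. \<delta> t < a"
      by (rule delta_eventually_less)
  next
    fix a :: real assume a: "a < 1"
    show "\<forall>\<^sub>F t in nhds 0. a < \<delta> t"
    proof (cases "a \<le> 0")
      case True
      then show ?thesis
        by (auto intro!: always_eventually intro: le_less_trans)
    next
      case False
      then have "\<forall>\<^sub>F t in nhds 0. \<delta> t < inverse a"
        using a by (intro delta_eventually_less) (simp add: one_less_inverse_iff)
      then have "\<forall>\<^sub>F t in nhds 0. \<delta> (- t) < inverse a"
        using tendsto_uminus_nhds[of "0::'g"] by (auto simp: filterlim_iff)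
      then show ?thesis
        by eventually_elim (use False in \<open>simp add: delta_minus inverse_less_iff_less\<close>)
    qed
  qed
  moreover have "((\<lambda>t. - s + t) \<longlongrightarrow> 0) (nhds s)" for s :: 'g
    using tendsto_add[OF tendsto_const filterlim_ident, of "- s" s] by simp
  ultimately have "((\<lambda>t. \<delta> s * \<delta> (- s + t)) \<longlongrightarrow> \<delta> s * 1) (nhds s)" for s
    by (intro tendsto_mult tendsto_const) (rule filterlim_compose)
  then have "(\<delta> \<longlongrightarrow> \<delta> s) (nhds s)" for s
    by (simp add: delta_add[symmetric] add.assoc[symmetric])
  then show ?thesis
    unfolding continuous_on_def using tendsto_mono[OF at_within_le_nhds] by blast
qed

lemma delta_measurable [measurable]: "\<delta> \<in> borel_measurable borel"
  by (intro borel_measurable_continuous_onI delta_continuous)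

section \<open>The inversion formula for continuous functions\<close>

text \<open>Multiply both sides by \<open>\<integral>\<phi> > 0\<close>, insert translations into the double integral, and
  exchange the order of integration twice.\<close>

lemma nn_integral_inverse_compact_support:
  fixes h :: "'g \<Rightarrow> real"
  assumes h: "continuous_on UNIV h" "\<And>s. 0 \<le> h s" and A: "compact A" "\<And>s. s \<notin> A \<Longrightarrow> h s = 0"
  shows "(\<integral>\<^sup>+ s. ennreal (h (- s)) \<partial>\<mu>) = (\<integral>\<^sup>+ s. ennreal (inverse (\<delta> s) * h s) \<partial>\<mu>)"
proof -
  obtain K where K: "compact K" "K \<in> sets borel" "0 < emeasure \<mu> K" "emeasure \<mu> K < \<infinity>"
    by (rule obtain_compact_pos)
  \<comment> \<open>\<open>\<phi>\<close> is 1 on \<open>K\<close> and vanishes off a compact set,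
    so that its integral \<open>I\<close> is positive and finite and can be cancelled at the
    end.\<close>
  obtain \<phi> :: "'g \<Rightarrow> real" and B where \<phi>: "continuous_on UNIV \<phi>" "compact B" "\<And>x. 0 \<le> \<phi> x"
    "\<And>x. \<phi> x \<le> 1" "\<And>x. x \<in> K \<Longrightarrow> \<phi> x = 1" "\<And>x. x \<notin> B \<Longrightarrow> \<phi> x = 0"
    using urysohn_compact_support[OF lc K(1) open_UNIV subset_UNIV] by metis
  have hm [measurable]: "h \<in> borel_measurable borel" "\<phi> \<in> borel_measurable borel" "B \<in> sets borel"
    using h \<phi> by (auto intro: borel_measurable_continuous_onI simp: borel_closed compact_imp_closed)
  define AB where "AB = (\<lambda>p. fst p + snd p) ` (A \<times> B)"
  have AB: "compact AB" "compact (uminus ` A)"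
    unfolding AB_def by (intro compact_continuous_image continuous_intros compact_Times A \<phi>)+
  have nn: "0 \<le> \<delta> s" for s
    by (simp add: less_imp_le)
  define I where "I = (\<integral>\<^sup>+ s. ennreal (\<phi> s) \<partial>\<mu>)"
  have "(\<integral>\<^sup>+ s. ennreal (h (- s)) \<partial>\<mu>) * I = (\<integral>\<^sup>+ s. \<integral>\<^sup>+ t. ennreal (h (- s) * \<phi> (s + t)) \<partial>\<mu> \<partial>\<mu>)"
    unfolding I_def
    by (simp add: ennreal_mult h \<phi> nn_integral_cmult nn_integral_left[of "\<lambda>s. ennreal (\<phi> s)"] nn_integral_multc)
  also have "\<dots> = (\<integral>\<^sup>+ t. \<integral>\<^sup>+ s. ennreal (h (- s) * \<phi> (s + t)) \<partial>\<mu> \<partial>\<mu>)"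
  proof (rule nn_integral_swap_compact_support[where K = "uminus ` A" and L = AB])
    show "continuous_on UNIV (\<lambda>p. h (- fst p) * \<phi> (fst p + snd p))"
      by (intro continuous_intros continuous_on_compose2[OF h(1)] continuous_on_compose2[OF \<phi>(1)]) auto
    fix s t assume *: "h (- s) * \<phi> (s + t) \<noteq> 0"
    then have "- s \<in> A" "s + t \<in> B"
      using A(2) \<phi>(6) by fastforce+
    moreover have "s = - (- s)" "t = fst (- s, s + t) + snd (- s, s + t)"
      by (simp_all add: add.assoc[symmetric])
    ultimately show "s \<in> uminus ` A \<and> t \<in> AB"
      unfolding AB_def by blast
  qed (use AB finite_on_compact in auto)
  also have "\<dots> = (\<integral>\<^sup>+ t. \<integral>\<^sup>+ s. ennreal (\<delta> (- t) * h (t - s) * \<phi> s) \<partial>\<mu> \<partial>\<mu>)"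
  proof (rule nn_integral_cong)
    fix t :: 'g
    have [measurable]: "(\<lambda>s. t - s) \<in> borel_measurable borel"
      by (intro borel_measurable_continuous_onI continuous_on_op_minus)
    have "(\<integral>\<^sup>+ s. ennreal (h (- s) * \<phi> (s + t)) \<partial>\<mu>) = (\<integral>\<^sup>+ s. ennreal (h (t - (s + t)) * \<phi> (s + t)) \<partial>\<mu>)"
      by (simp add: diff_conv_add_uminus minus_add add.assoc[symmetric] del: add_uminus_conv_diff)
    also have "\<dots> = ennreal (\<delta> (- t)) * (\<integral>\<^sup>+ s. ennreal (h (t - s) * \<phi> s) \<partial>\<mu>)"
      by (rule nn_integral_right) measurable
    also have "\<dots> = (\<integral>\<^sup>+ s. ennreal (\<delta> (- t) * h (t - s) * \<phi> s) \<partial>\<mu>)"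
      by (subst nn_integral_cmult[symmetric]) (auto simp: ennreal_mult h \<phi> nn mult.assoc)
    finally show "(\<integral>\<^sup>+ s. ennreal (h (- s) * \<phi> (s + t)) \<partial>\<mu>) = (\<integral>\<^sup>+ s. ennreal (\<delta> (- t) * h (t - s) * \<phi> s) \<partial>\<mu>)" .
  qed
  also have "\<dots> = (\<integral>\<^sup>+ s. \<integral>\<^sup>+ t. ennreal (\<delta> (- t) * h (t - s) * \<phi> s) \<partial>\<mu> \<partial>\<mu>)"
  proof (rule nn_integral_swap_compact_support[where K = AB and L = B])
    show "continuous_on UNIV (\<lambda>p. \<delta> (- fst p) * h (fst p - snd p) * \<phi> (snd p))"
      by (intro continuous_intros continuous_on_compose2[OF h(1)] continuous_on_compose2[OF \<phi>(1)]
          continuous_on_compose2[OF delta_continuous[of UNIV]]) auto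
    fix t s assume *: "\<delta> (- t) * h (t - s) * \<phi> s \<noteq> 0"
    then have "t - s \<in> A" "s \<in> B"
      using A(2) \<phi>(6) by fastforce+
    moreover have "t = fst (t - s, s) + snd (t - s, s)"
      by simp
    ultimately show "t \<in> AB \<and> s \<in> B"
      unfolding AB_def by blast
  qed (use AB finite_on_compact \<phi>(2) in auto)
  also have "\<dots> = (\<integral>\<^sup>+ s. (\<integral>\<^sup>+ t. ennreal (inverse (\<delta> t) * h t) \<partial>\<mu>) * ennreal (\<phi> s) \<partial>\<mu>)"
  proof (rule nn_integral_cong)
    fix s :: 'g
    have "(\<integral>\<^sup>+ t. ennreal (\<delta> (- t) * h (t - s) * \<phi> s) \<partial>\<mu>)
        = (\<integral>\<^sup>+ t. ennreal (\<delta> (- (t + - s + s)) * h (t + - s) * \<phi> s) \<partial>\<mu>)"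
      by simp
    also have "\<dots> = ennreal (\<delta> (- (- s))) * (\<integral>\<^sup>+ t. ennreal (\<delta> (- (t + s)) * h t * \<phi> s) \<partial>\<mu>)"
      by (rule nn_integral_right) measurable
    also have "\<dots> = (\<integral>\<^sup>+ t. ennreal (\<delta> s) * ennreal (\<delta> (- (t + s)) * h t * \<phi> s) \<partial>\<mu>)"
      by (subst nn_integral_cmult) auto
    also have "\<dots> = (\<integral>\<^sup>+ t. ennreal (inverse (\<delta> t) * h t) * ennreal (\<phi> s) \<partial>\<mu>)"
    proof (rule nn_integral_cong)
      fix t
      \<comment> \<open>The factor \<open>\<delta> s\<close> produced by the second right
        translation cancels the one hidden in \<open>\<delta> (- (t + s))\<close>, so that only
        \<open>\<phi> s\<close> still depends on \<open>s\<close>.\<close>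
      have "\<delta> s * (\<delta> (- (t + s)) * h t * \<phi> s) = inverse (\<delta> t) * h t * \<phi> s"
        using less_imp_neq[OF delta_pos[of s]] by (simp add: delta_minus delta_add)
      then show "ennreal (\<delta> s) * ennreal (\<delta> (- (t + s)) * h t * \<phi> s) = ennreal (inverse (\<delta> t) * h t) * ennreal (\<phi> s)"
        by (simp add: ennreal_mult[symmetric] h \<phi> nn)
    qed
    also have "\<dots> = (\<integral>\<^sup>+ t. ennreal (inverse (\<delta> t) * h t) \<partial>\<mu>) * ennreal (\<phi> s)"
      by (rule nn_integral_multc) measurable
    finally show "(\<integral>\<^sup>+ t. ennreal (\<delta> (- t) * h (t - s) * \<phi> s) \<partial>\<mu>)
      = (\<integral>\<^sup>+ t. ennreal (inverse (\<delta> t) * h t) \<partial>\<mu>) * ennreal (\<phi> s)" .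
  qed
  also have "\<dots> = (\<integral>\<^sup>+ t. ennreal (inverse (\<delta> t) * h t) \<partial>\<mu>) * I"
    unfolding I_def by (rule nn_integral_cmult) measurable
  finally have eq: "(\<integral>\<^sup>+ s. ennreal (h (- s)) \<partial>\<mu>) * I = (\<integral>\<^sup>+ t. ennreal (inverse (\<delta> t) * h t) \<partial>\<mu>) * I" .
  have "emeasure \<mu> K = (\<integral>\<^sup>+ s. indicator K s \<partial>\<mu>)"
    using K(2) by simp
  also have "\<dots> \<le> I"
    unfolding I_def by (intro nn_integral_mono) (auto simp: indicator_def \<phi>)
  finally have "I \<noteq> 0"
    using K(3) by auto
  have "I \<le> (\<integral>\<^sup>+ s. indicator B s \<partial>\<mu>)"
    unfolding I_def by (intro nn_integral_mono) (auto simp: indicator_def \<phi>)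
  also have "\<dots> < \<infinity>"
    using finite_on_compact[OF \<phi>(2)] by simp
  finally have "I < \<infinity>" .
  with eq \<open>I \<noteq> 0\<close> show ?thesis
    by (auto simp: mult.commute[of _ I] ennreal_mult_cancel_left)
qed

text \<open>Inner regularity reduces the preimage of \<open>U\<close> to compact sets
  \<open>K\<close>, and a cutoff that is 1 on the inverses of \<open>K\<close> and 0 off
  \<open>U\<close> obeys the formula for compact support. The argument exhausts the left side from
  inside and so yields an inequality only.\<close>

lemma emeasure_inverse_open_le:
  assumes U: "open U"
  shows "emeasure (distr \<mu> borel uminus) U \<le> emeasure (density \<mu> (\<lambda>s. ennreal (inverse (\<delta> s)))) U"
proof -
  have meas [measurable]: "U \<in> sets borel"
    using U by simp
  have "open (uminus -` U)"
    by (intro open_vimage U continuous_intros)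
  have "emeasure (distr \<mu> borel uminus) U = emeasure \<mu> (uminus -` U)"
    by (simp add: emeasure_distr)
  also have "\<dots> = (SUP K\<in>{K. compact K \<and> K \<subseteq> uminus -` U}. emeasure \<mu> K)"
    by (rule inner_regular) fact
  also have "\<dots> \<le> emeasure (density \<mu> (\<lambda>s. ennreal (inverse (\<delta> s)))) U"
  proof (rule SUP_least)
    fix K assume "K \<in> {K. compact K \<and> K \<subseteq> uminus -` U}"
    then have K: "compact K" "K \<subseteq> uminus -` U"
      by auto
    then have [measurable]: "K \<in> sets borel"
      by (simp add: borel_closed compact_imp_closed)
    have "compact (uminus ` K)" "uminus ` K \<subseteq> U"
      using K by (auto intro!: compact_continuous_image continuous_intros)
    then obtain f :: "'g \<Rightarrow> real" and L where f: "continuous_on UNIV f" "compact L" "\<And>x. 0 \<le> f x"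
      "\<And>x. f x \<le> 1" "\<And>x. x \<in> uminus ` K \<Longrightarrow> f x = 1" "\<And>x. x \<notin> L \<Longrightarrow> f x = 0" "\<And>x. x \<notin> U \<Longrightarrow> f x = 0"
      using urysohn_compact_support[OF lc _ U] by metis
    have "emeasure \<mu> K = (\<integral>\<^sup>+ s. indicator K s \<partial>\<mu>)"
      by simp
    also have "\<dots> \<le> (\<integral>\<^sup>+ s. ennreal (f (- s)) \<partial>\<mu>)"
      by (intro nn_integral_mono) (auto simp: indicator_def f)
    also have "\<dots> = (\<integral>\<^sup>+ s. ennreal (inverse (\<delta> s) * f s) \<partial>\<mu>)"
      by (rule nn_integral_inverse_compact_support) (use f in auto)
    also have "\<dots> \<le> (\<integral>\<^sup>+ s. ennreal (inverse (\<delta> s)) * indicator U s \<partial>\<mu>)"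
      by (intro nn_integral_mono)
        (auto simp: indicator_def f mult_left_le less_imp_le intro!: ennreal_leI)
    also have "\<dots> = emeasure (density \<mu> (\<lambda>s. ennreal (inverse (\<delta> s)))) U"
      by (simp add: emeasure_density)
    finally show "emeasure \<mu> K \<le> emeasure (density \<mu> (\<lambda>s. ennreal (inverse (\<delta> s)))) U" .
  qed
  finally show ?thesis .
qed

text \<open>The comparison on open sets passes to integrals of continuous functions. Compact support
  is dropped here because coefficient functions need not have it.\<close>

lemma nn_integral_inverse_le:
  fixes h :: "'g \<Rightarrow> real"
  assumes h: "continuous_on UNIV h" "\<And>s. 0 \<le> h s"
  shows "(\<integral>\<^sup>+ s. ennreal (h (- s)) \<partial>\<mu>) \<le> (\<integral>\<^sup>+ s. ennreal (inverse (\<delta> s) * h s) \<partial>\<mu>)"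
proof -
  have [measurable]: "h \<in> borel_measurable borel"
    using h by (simp add: borel_measurable_continuous_onI)
  have "(\<integral>\<^sup>+ s. ennreal (h (- s)) \<partial>\<mu>) = (\<integral>\<^sup>+ s. ennreal (h s) \<partial>distr \<mu> borel uminus)"
    by (rule nn_integral_distr[symmetric]) measurable
  also have "\<dots> \<le> (\<integral>\<^sup>+ s. ennreal (h s) \<partial>density \<mu> (\<lambda>s. ennreal (inverse (\<delta> s))))"
    by (rule nn_integral_mono_open) (simp_all add: emeasure_inverse_open_le h)
  also have "\<dots> = (\<integral>\<^sup>+ s. ennreal (inverse (\<delta> s) * h s) \<partial>\<mu>)"
    by (simp add: nn_integral_density ennreal_mult h less_imp_le)
  finally show ?thesis .
qed

text \<open>The reverse inequality is the previous lemma for \<open>\<lambda>s. \<delta> s * h (- s)\<close>.\<close>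

lemma nn_integral_inverse:
  fixes h :: "'g \<Rightarrow> real"
  assumes h: "continuous_on UNIV h" "\<And>s. 0 \<le> h s"
  shows "(\<integral>\<^sup>+ s. ennreal (h (- s)) \<partial>\<mu>) = (\<integral>\<^sup>+ s. ennreal (inverse (\<delta> s) * h s) \<partial>\<mu>)"
proof (rule antisym[OF nn_integral_inverse_le[OF h]])
  have "(\<integral>\<^sup>+ s. ennreal (\<delta> (- s) * h (- (- s))) \<partial>\<mu>) \<le> (\<integral>\<^sup>+ s. ennreal (inverse (\<delta> s) * (\<delta> s * h (- s))) \<partial>\<mu>)"
    by (rule nn_integral_inverse_le)
      (auto intro!: continuous_intros delta_continuous continuous_on_compose2[OF h(1)] simp: h less_imp_le)
  moreover have "inverse (\<delta> s) * (\<delta> s * h (- s)) = h (- s)" for s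
    using less_imp_neq[OF delta_pos[of s]] by simp
  ultimately show "(\<integral>\<^sup>+ s. ennreal (inverse (\<delta> s) * h s) \<partial>\<mu>) \<le> (\<integral>\<^sup>+ s. ennreal (h (- s)) \<partial>\<mu>)"
    by (simp add: delta_minus)
qed

end

section \<open>Complex Hilbert spaces and square-integrable functions\<close>

lemma cinner_add_right: "cinner (x::'h::complex_inner) (y + z) = cinner x y + cinner x z"
  by (metis cinner_add_left cinner_commute complex_cnj_add)

lemma cinner_scaleC_right: "cinner (x::'h::complex_inner) (c *\<^sub>C y) = cnj c * cinner x y"
  by (metis cinner_scaleC_left cinner_commute complex_cnj_mult)

lemma cinner_scaleR_left: "cinner (r *\<^sub>R x) (y::'h::complex_inner) = complex_of_real r * cinner x y"
  by (simp add: scaleR_scaleC cinner_scaleC_left)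

lemma cinner_scaleR_right: "cinner (x::'h::complex_inner) (r *\<^sub>R y) = complex_of_real r * cinner x y"
  by (simp add: scaleR_scaleC cinner_scaleC_right)

lemma cinner_zero_left [simp]: "cinner 0 (y::'h::complex_inner) = 0"
  using cinner_scaleR_left[of 0 0 y] by simp

lemma cinner_zero_right [simp]: "cinner (x::'h::complex_inner) 0 = 0"
  using cinner_scaleR_right[of x 0 0] by simp

lemma cinner_diff_left: "cinner (x - y) (z::'h::complex_inner) = cinner x z - cinner y z"
  using cinner_add_left[of "x - y" y z] by simp

lemma cinner_self: "cinner x x = complex_of_real ((norm (x::'h::complex_inner))\<^sup>2)"
proof (rule complex_eqI)
  show "Re (cinner x x) = Re (complex_of_real ((norm x)\<^sup>2))"
    by (simp add: norm_eq_sqrt_cinner cinner_ge_zero)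
  have "Im (cinner x x) = - Im (cinner x x)"
    by (subst (1) cinner_commute) simp
  then show "Im (cinner x x) = Im (complex_of_real ((norm x)\<^sup>2))"
    by simp
qed

lemma norm_add_squared:
  "(norm (x + y :: 'h::complex_inner))\<^sup>2 = (norm x)\<^sup>2 + (norm y)\<^sup>2 + 2 * Re (cinner x y)"
proof -
  have "Re (cinner y x) = Re (cinner x y)"
    by (subst cinner_commute) simp
  moreover have "(norm (x + y))\<^sup>2 = Re (cinner (x + y) (x + y))"
    by (simp add: cinner_self)
  moreover have "\<dots> = Re (cinner x x) + Re (cinner y y) + Re (cinner x y) + Re (cinner y x)"
    by (simp add: cinner_add_left cinner_add_right)
  ultimately show ?thesis
    by (simp add: cinner_self)
qed

lemma parallelogram:
  "(norm (x + y :: 'h::complex_inner))\<^sup>2 + (norm (x - y))\<^sup>2 = 2 * (norm x)\<^sup>2 + 2 * (norm y)\<^sup>2"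
  using norm_add_squared[of x y] norm_add_squared[of x "- y"] cinner_scaleR_right[of x "-1" y] by simp

lemma norm_scaleC: "norm (c *\<^sub>C (x::'h::complex_inner)) = cmod c * norm x"
proof -
  have "complex_of_real ((norm (c *\<^sub>C x))\<^sup>2) = complex_of_real ((cmod c * norm x)\<^sup>2)"
    unfolding cinner_self[symmetric] cinner_scaleC_left cinner_scaleC_right
    by (simp add: cinner_self power_mult_distrib complex_norm_square mult.assoc del: of_real_power)
  then show ?thesis
    by (simp only: of_real_eq_iff power2_eq_iff_nonneg norm_ge_zero mult_nonneg_nonneg)
qed

text \<open>The triangle inequality belongs to the class of normed spaces, so it bounds the real
  part directly; rotating \<open>x\<close> by a scalar turns the real part into the modulus.\<close>

lemma cinner_Cauchy_Schwarz: "cmod (cinner x y) \<le> norm (x::'h::complex_inner) * norm y"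
proof -
  have re: "Re (cinner x y) \<le> norm x * norm y" for x y :: 'h
  proof -
    have "(norm (x + y))\<^sup>2 \<le> (norm x + norm y)\<^sup>2"
      by (intro power_mono norm_triangle_ineq) simp
    then show ?thesis
      by (simp add: norm_add_squared power2_sum)
  qed
  \<comment> \<open>\<open>u\<close> has modulus 1, or 0 if the inner product vanishes, since
    \<open>sgn 0 = 0\<close>; hence only \<open>\<le>\<close> is claimed for the norm of
    \<open>u *\<^sub>C x\<close>.\<close>
  define u where "u = cnj (sgn (cinner x y))"
  have "Re (cinner (u *\<^sub>C x) y) = cmod (cinner x y)"
    by (simp add: cinner_scaleC_left u_def sgn_eq mult.commute[of _ "cinner x y"] complex_norm_square[symmetric]
        power2_eq_square)
  moreover have "norm (u *\<^sub>C x) \<le> norm x"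
    by (auto simp: norm_scaleC u_def norm_sgn)
  ultimately show ?thesis
    using re[of "u *\<^sub>C x" y] by (metis mult_right_mono norm_ge_zero order_trans)
qed

interpretation cinner: bounded_bilinear "cinner :: 'h::complex_inner \<Rightarrow> 'h \<Rightarrow> complex"
proof
  show "\<exists>K. \<forall>a b. norm (cinner a b) \<le> norm (a::'h) * norm b * K"
    by (intro exI[of _ 1]) (simp add: cinner_Cauchy_Schwarz)
qed (simp_all add: cinner_add_left cinner_add_right cinner_scaleR_left cinner_scaleR_right scaleR_conv_of_real)

text \<open>The linear term dominates for small \<open>t\<close>: at \<open>t = - e * b\<close> with
  \<open>e * \<bar>a\<bar> < 1\<close> the expression would be negative unless \<open>b = 0\<close>.
  This serves as the first-order condition at a minimizer.\<close>

lemma quadratic_nonneg_imp_zero: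
  fixes a b :: real
  assumes "\<And>t. 0 \<le> t\<^sup>2 * a + 2 * t * b"
  shows "b = 0"
proof (rule ccontr)
  assume b: "b \<noteq> 0"
  define e where "e = 1 / (\<bar>a\<bar> + 1)"
  have e: "0 < e" "e * \<bar>a\<bar> < 1"
    by (auto simp: e_def field_simps)
  have "0 \<le> (- e * b)\<^sup>2 * a + 2 * (- e * b) * b"
    by (rule assms)
  also have "\<dots> = e * b\<^sup>2 * (e * a - 2)"
    by (simp add: power2_eq_square algebra_simps)
  finally have "0 \<le> e * a - 2"
    using mult_pos_pos[OF e(1), of "b\<^sup>2"] b by (simp add: zero_le_mult_iff not_le[symmetric])
  moreover have "e * a \<le> e * \<bar>a\<bar>"
    using e(1) by simp
  ultimately show False
    using e(2) by linarith
qed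

text \<open>With \<open>D = UNIV\<close> this is the Riesz representation theorem, and with \<open>F v = Re (cinner x v)\<close> it
  gives the orthogonal projection of \<open>x\<close>. The vector \<open>p\<close> minimizes \<open>\<parallel>x\<parallel>\<^sup>2 - 2 F x\<close>, and the
  parallelogram law makes minimizing sequences Cauchy.\<close>

lemma riesz_subspace:
  fixes D :: "'h::chilbert_space set" and F :: "'h \<Rightarrow> real"
  assumes D: "subspace D" and F: "bounded_linear F"
  shows "\<exists>p\<in>closure D. \<forall>v\<in>D. Re (cinner p v) = F v"
proof -
  interpret F: bounded_linear F
    by (rule F)
  obtain C where C: "\<And>x. norm (F x) \<le> norm x * C"
    using F.bounded by blast
  define J where "J = (\<lambda>x. (norm x)\<^sup>2 - 2 * F x)"
  have "- C\<^sup>2 \<le> J x" for x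
  proof -
    have "0 \<le> (norm x - C)\<^sup>2"
      by simp
    moreover have "F x \<le> norm x * C"
      using C[of x] by simp
    ultimately show ?thesis
      by (simp add: J_def power2_diff)
  qed
  then have bdd: "bdd_below (J ` D)"
    by (intro bdd_belowI[of _ "- C\<^sup>2"]) auto
  define m where "m = Inf (J ` D)"
  have m_le: "m \<le> J x" if "x \<in> D" for x
    unfolding m_def using that bdd by (intro cInf_lower) auto
  have "\<exists>x\<in>D. J x < m + inverse (real (Suc n))" for n
  proof -
    have "Inf (J ` D) < m + inverse (real (Suc n))"
      by (simp add: m_def)
    moreover have "J ` D \<noteq> {}"
      using subspace_0[OF D] by auto
    ultimately show ?thesis
      using bdd by (simp add: cInf_less_iff)
  qed
  then obtain x where x: "\<And>n. x n \<in> D" "\<And>n. J (x n) < m + inverse (real (Suc n))"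
    by metis
  \<comment> \<open>The midpoint of \<open>y\<close> and \<open>z\<close> lies in \<open>D\<close>,
    so that \<open>J\<close> is at least \<open>m\<close> there; the parallelogram law turns this
    into a bound for the distance.\<close>
  have diff: "(norm (y - z))\<^sup>2 \<le> 2 * (J y - m) + 2 * (J z - m)" if "y \<in> D" "z \<in> D" for y z
  proof -
    have "m \<le> J ((1/2) *\<^sub>R (y + z))"
      using that D by (intro m_le subspace_scale subspace_add)
    also have "\<dots> = (norm (y + z))\<^sup>2 / 4 - (F y + F z)"
      unfolding J_def F.scaleR F.add norm_scaleR by (simp add: power_divide add_divide_distrib)
    finally show ?thesis
      using parallelogram[of y z] by (simp add: J_def)
  qed
  have "Cauchy x"
  proof (rule metric_CauchyI)
    fix e :: real assume e: "0 < e"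
    obtain N where N: "inverse (real (Suc N)) < e\<^sup>2 / 4"
      using reals_Archimedean[of "e\<^sup>2 / 4"] e by auto
    have "dist (x i) (x j) < e" if "N \<le> i" "N \<le> j" for i j
    proof -
      have "J (x k) - m < e\<^sup>2 / 4" if "N \<le> k" for k
      proof -
        have "inverse (real (Suc k)) \<le> inverse (real (Suc N))"
          using that by (intro le_imp_inverse_le) auto
        with x(2)[of k] N show ?thesis
          by linarith
      qed
      from this[OF that(1)] this[OF that(2)]
      have "2 * (J (x i) - m) + 2 * (J (x j) - m) < 2 * (e\<^sup>2 / 4) + 2 * (e\<^sup>2 / 4)"
        by (intro add_strict_mono mult_strict_left_mono) auto
      with diff[OF x(1) x(1), of i j] have "(norm (x i - x j))\<^sup>2 < e\<^sup>2"
        by simp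
      then show ?thesis
        using e by (simp add: dist_norm power2_less_imp_less)
    qed
    then show "\<exists>N. \<forall>i\<ge>N. \<forall>j\<ge>N. dist (x i) (x j) < e"
      by blast
  qed
  then obtain p where p: "x \<longlonglongrightarrow> p"
    using Cauchy_convergent convergent_def by blast
  have J_tendsto: "(\<lambda>n. J (y n)) \<longlonglongrightarrow> J z" if "y \<longlonglongrightarrow> z" for y z
    unfolding J_def by (intro tendsto_intros F.tendsto that)
  have "(\<lambda>n. J (x n)) \<longlonglongrightarrow> m"
  proof (rule tendsto_sandwich[of "\<lambda>_. m" _ _ "\<lambda>n. m + inverse (real (Suc n))"])
    show "(\<lambda>n. m + inverse (real (Suc n))) \<longlonglongrightarrow> m"
      using tendsto_add[OF tendsto_const[of m] LIMSEQ_inverse_real_of_nat] by simp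
  qed (use m_le x in \<open>auto intro!: always_eventually less_imp_le\<close>)
  then have Jp: "J p = m"
    using J_tendsto[OF p] LIMSEQ_unique by blast
  have "Re (cinner p v) = F v" if v: "v \<in> D" for v
  proof -
    have "0 \<le> t\<^sup>2 * (norm v)\<^sup>2 + 2 * t * (Re (cinner p v) - F v)" for t
    proof -
      \<comment> \<open>\<open>p\<close> need not lie in \<open>D\<close>, so minimality is applied
        to \<open>x n + t *\<^sub>R v\<close> and passed to the limit.\<close>
      have "(\<lambda>n. J (x n + t *\<^sub>R v)) \<longlonglongrightarrow> J (p + t *\<^sub>R v)"
        by (intro J_tendsto tendsto_intros p)
      then have "J p \<le> J (p + t *\<^sub>R v)"
        unfolding Jp by (rule LIMSEQ_le_const) (use x(1) v D in \<open>auto intro!: m_le subspace_add subspace_scale\<close>)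
      then show ?thesis
        by (simp add: J_def norm_add_squared F.add F.scaleR cinner_scaleR_right power_mult_distrib algebra_simps)
    qed
    then show ?thesis
      using quadratic_nonneg_imp_zero by fastforce
  qed
  moreover have "p \<in> closure D"
    using p x(1) closure_sequential by blast
  ultimately show ?thesis
    by blast
qed

text \<open>The real part determines \<open>p\<close> by the real Riesz theorem; evaluating at
  \<open>\<i> *\<^sub>C v\<close> recovers the imaginary part.\<close>

lemma riesz_antilinear:
  fixes G :: "'h::chilbert_space \<Rightarrow> complex"
  assumes bl: "bounded_linear (\<lambda>x. Re (G x))" and i: "\<And>x. G (\<i> *\<^sub>C x) = - \<i> * G x"
  shows "\<exists>p. \<forall>v. cinner p v = G v"
proof -
  obtain p where p: "\<And>v. Re (cinner p v) = Re (G v)"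
    using riesz_subspace[OF subspace_UNIV bl] by auto
  have "Im (cinner p v) = Im (G v)" for v
    using p[of "\<i> *\<^sub>C v"] by (simp add: i cinner_scaleC_right)
  with p show ?thesis
    by (auto intro!: exI[of _ p] complex_eqI)
qed

section \<open>Inner products of square-integrable functions\<close>

lemma L2_mult_cnj_integrable:
  assumes "f \<in> L2 M" "g \<in> L2 M"
  shows "integrable M (\<lambda>s. f s * cnj (g s))"
proof (rule Bochner_Integration.integrable_bound)
  show "integrable M (\<lambda>s. (cmod (f s))\<^sup>2 + (cmod (g s))\<^sup>2)"
    using assms by (simp add: L2_def)
  show "(\<lambda>s. f s * cnj (g s)) \<in> borel_measurable M"
    using assms borel_measurable_continuous_on[of cnj g M]
    by (auto simp: L2_def continuous_on_cnj intro!: borel_measurable_times)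
  have "cmod (f s) * cmod (g s) \<le> (cmod (f s))\<^sup>2 + (cmod (g s))\<^sup>2" for s
    using sum_squares_bound[of "cmod (f s)" "cmod (g s)"] mult_nonneg_nonneg[of "cmod (f s)" "cmod (g s)"]
    unfolding mult.assoc by (simp del: mult_nonneg_nonneg)
  then show "AE s in M. norm (f s * cnj (g s)) \<le> norm ((cmod (f s))\<^sup>2 + (cmod (g s))\<^sup>2)"
    by (simp add: norm_mult)
qed

lemma cmod_add_squared: "(cmod (a + b))\<^sup>2 = (cmod a)\<^sup>2 + (cmod b)\<^sup>2 + 2 * Re (a * cnj b)"
  unfolding cmod_power2 by (simp add: power2_eq_square algebra_simps)

lemma L2_add:
  assumes "f \<in> L2 M" "g \<in> L2 M"
  shows "(\<lambda>s. f s + g s) \<in> L2 M"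
  using assms L2_mult_cnj_integrable[OF assms] unfolding L2_def mem_Collect_eq cmod_add_squared
  by (auto intro!: borel_measurable_add simp del: times_complex.sel)

lemma L2_scale:
  assumes "f \<in> L2 M"
  shows "(\<lambda>s. c * f s) \<in> L2 M"
  using assms unfolding L2_def by (auto simp: norm_mult power_mult_distrib intro: borel_measurable_times)

lemma L2_inner_self:
  "L2_inner M f f = complex_of_real (\<integral>s. (cmod (f s))\<^sup>2 \<partial>M)"
  by (simp add: L2_inner_def complex_norm_square[symmetric] del: of_real_power)

lemma L2_inner_add_left:
  assumes "f \<in> L2 M" "g \<in> L2 M" "h \<in> L2 M"
  shows "L2_inner M (\<lambda>s. f s + g s) h = L2_inner M f h + L2_inner M g h"
  using assms by (simp add: L2_inner_def distrib_right L2_mult_cnj_integrable)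

lemma L2_inner_add_right:
  assumes "f \<in> L2 M" "g \<in> L2 M" "h \<in> L2 M"
  shows "L2_inner M f (\<lambda>s. g s + h s) = L2_inner M f g + L2_inner M f h"
  using assms by (simp add: L2_inner_def distrib_left L2_mult_cnj_integrable)

lemma L2_inner_scale_left: "L2_inner M (\<lambda>s. c * f s) g = c * L2_inner M f g"
  by (simp add: L2_inner_def mult.assoc)

lemma L2_inner_scale_right: "L2_inner M f (\<lambda>s. c * g s) = cnj c * L2_inner M f g"
  by (simp add: L2_inner_def mult.left_commute)

lemma integral_cmod_add_squared:
  assumes "f \<in> L2 M" "g \<in> L2 M"
  shows "(\<integral>s. (cmod (f s + g s))\<^sup>2 \<partial>M) =
    (\<integral>s. (cmod (f s))\<^sup>2 \<partial>M) + (\<integral>s. (cmod (g s))\<^sup>2 \<partial>M) + 2 * Re (L2_inner M f g)"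
  using assms L2_mult_cnj_integrable[OF assms] unfolding cmod_add_squared L2_inner_def
  by (simp add: L2_def integrable_Re del: times_complex.sel)

text \<open>Expanding the nonnegative squared norms of \<open>f + g\<close> and \<open>f - g\<close>
  gives this weak form of Cauchy-Schwarz. It suffices for boundedness, because vectors can be
  normalized first.\<close>

lemma L2_inner_bound:
  assumes "f \<in> L2 M" "g \<in> L2 M"
  shows "\<bar>Re (L2_inner M f g)\<bar> \<le> ((\<integral>s. (cmod (f s))\<^sup>2 \<partial>M) + (\<integral>s. (cmod (g s))\<^sup>2 \<partial>M)) / 2"
proof -
  have "0 \<le> (\<integral>s. (cmod (f s + g s))\<^sup>2 \<partial>M)" "0 \<le> (\<integral>s. (cmod (f s + - 1 * g s))\<^sup>2 \<partial>M)"
    by simp_all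
  then show ?thesis
    unfolding integral_cmod_add_squared[OF assms] integral_cmod_add_squared[OF assms(1) L2_scale[OF assms(2), of "- 1"]]
      L2_inner_scale_right
    by simp
qed

section \<open>Admissibility as an isometry condition\<close>

lemma coeff_op_add: "coeff_op \<pi> \<eta> (x + y) = (\<lambda>s. coeff_op \<pi> \<eta> x s + coeff_op \<pi> \<eta> y s)"
  by (simp add: coeff_op_def cinner_add_left)

lemma coeff_op_scaleC: "coeff_op \<pi> \<eta> (c *\<^sub>C x) = (\<lambda>s. c * coeff_op \<pi> \<eta> x s)"
  by (simp add: coeff_op_def cinner_scaleC_left)

lemma coeff_op_scaleR: "coeff_op \<pi> \<eta> (r *\<^sub>R x) = (\<lambda>s. complex_of_real r * coeff_op \<pi> \<eta> x s)"
  by (simp add: coeff_op_def cinner_scaleR_left)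

lemma coeff_op_diff: "coeff_op \<pi> \<eta> (x - y) = (\<lambda>s. coeff_op \<pi> \<eta> x s - coeff_op \<pi> \<eta> y s)"
  by (simp add: coeff_op_def cinner_diff_left)

definition isometric_into_L2 :: "'g measure \<Rightarrow> ('h::chilbert_space \<Rightarrow> 'g \<Rightarrow> complex) \<Rightarrow> bool" where
  "isometric_into_L2 M T \<longleftrightarrow> (\<forall>\<psi>. T \<psi> \<in> L2 M \<and> (\<integral>s. (cmod (T \<psi> s))\<^sup>2 \<partial>M) = (norm \<psi>)\<^sup>2)"

text \<open>Polarization: the norm identity at \<open>x + y\<close> yields the real parts, and
  replacing \<open>x\<close> by \<open>\<i> *\<^sub>C x\<close> yields the imaginary parts.\<close>

lemma isometric_into_L2_inner:
  assumes "isometric_into_L2 M (coeff_op \<pi> \<eta>)"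
  shows "L2_inner M (coeff_op \<pi> \<eta> x) (coeff_op \<pi> \<eta> y) = cinner x y"
proof -
  have T: "coeff_op \<pi> \<eta> x \<in> L2 M" "(\<integral>s. (cmod (coeff_op \<pi> \<eta> x s))\<^sup>2 \<partial>M) = (norm x)\<^sup>2" for x
    using assms by (simp_all add: isometric_into_L2_def)
  have re: "Re (L2_inner M (coeff_op \<pi> \<eta> x) (coeff_op \<pi> \<eta> y)) = Re (cinner x y)" for x y
    using integral_cmod_add_squared[OF T(1)[of x] T(1)[of y]] T(2)[of "x + y"]
    by (simp add: coeff_op_add T norm_add_squared)
  have "Im (L2_inner M (coeff_op \<pi> \<eta> x) (coeff_op \<pi> \<eta> y)) = Im (cinner x y)"
    using re[of "\<i> *\<^sub>C x" y] by (simp add: coeff_op_scaleC L2_inner_scale_left cinner_scaleC_left)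
  with re show ?thesis
    by (simp add: complex_eq_iff)
qed

text \<open>Testing \<open>S \<circ> coeff_op \<pi> \<eta> = id\<close> against
  \<open>\<psi>\<close> gives the norm identity. Conversely, the Riesz theorem supplies an adjoint,
  and preservation of inner products makes it a left inverse.\<close>

lemma admissible_iff_isometric: "admissible M \<pi> \<eta> \<longleftrightarrow> isometric_into_L2 M (coeff_op \<pi> \<eta>)"
proof
  assume "admissible M \<pi> \<eta>"
  then obtain S where L2: "\<And>\<psi>. coeff_op \<pi> \<eta> \<psi> \<in> L2 M" and S: "is_L2_adjoint M (coeff_op \<pi> \<eta>) S"
    and id: "S \<circ> coeff_op \<pi> \<eta> = id"
    unfolding admissible_def bounded_into_L2_def by blast
  have "complex_of_real (\<integral>s. (cmod (coeff_op \<pi> \<eta> \<psi> s))\<^sup>2 \<partial>M) = complex_of_real ((norm \<psi>)\<^sup>2)" for \<psi>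
    using S L2 fun_cong[OF id, of \<psi>] unfolding is_L2_adjoint_def
    by (metis L2_inner_self cinner_self comp_apply id_apply)
  then show "isometric_into_L2 M (coeff_op \<pi> \<eta>)"
    unfolding isometric_into_L2_def of_real_eq_iff using L2 by blast
next
  assume iso: "isometric_into_L2 M (coeff_op \<pi> \<eta>)"
  define T where "T = coeff_op \<pi> \<eta>"
  have T: "T x \<in> L2 M" "(\<integral>s. (cmod (T x s))\<^sup>2 \<partial>M) = (norm x)\<^sup>2" for x
    using iso by (simp_all add: isometric_into_L2_def T_def)
  have "\<exists>p. \<forall>\<psi>. cinner p \<psi> = L2_inner M f (T \<psi>)" if f: "f \<in> L2 M" for f
  proof (rule riesz_antilinear)
    define C where "C = ((\<integral>s. (cmod (f s))\<^sup>2 \<partial>M) + 1) / 2"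
    show "bounded_linear (\<lambda>x. Re (L2_inner M f (T x)))"
    proof (rule bounded_linear_intro)
      fix x
      show "norm (Re (L2_inner M f (T x))) \<le> norm x * C"
      proof (cases "x = 0")
        case True
        then show ?thesis
          by (simp add: T_def coeff_op_def L2_inner_def)
      next
        case False
        define u where "u = (1 / norm x) *\<^sub>R x"
        have u: "x = norm x *\<^sub>R u" "norm u = 1"
          using False by (simp_all add: u_def)
        have "\<bar>Re (L2_inner M f (T u))\<bar> \<le> C"
          using L2_inner_bound[OF f T(1)[of u]] by (simp add: T u C_def)
        moreover have "L2_inner M f (T x) = complex_of_real (norm x) * L2_inner M f (T u)"
          by (subst u(1)) (simp add: T_def coeff_op_scaleR L2_inner_scale_right)
        ultimately show ?thesis
          by (simp add: abs_mult mult_left_mono)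
      qed
    qed (simp_all add: T_def coeff_op_add coeff_op_scaleR L2_inner_scale_right L2_inner_add_right f T[unfolded T_def])
  qed (simp add: T_def coeff_op_scaleC L2_inner_scale_right)
  then obtain S where S: "\<And>f \<psi>. f \<in> L2 M \<Longrightarrow> cinner (S f) \<psi> = L2_inner M f (T \<psi>)"
    by metis
  have "S (T x) = x" for x
  proof -
    have "cinner (S (T x) - x) y = 0" for y
      using isometric_into_L2_inner[OF iso, of x y] by (simp add: cinner_diff_left S T(1)) (simp add: T_def)
    then show ?thesis
      using cinner_eq_zero_iff[of "S (T x) - x"] by simp
  qed
  moreover have "L2_norm M (T \<psi>) \<le> 1 * norm \<psi>" for \<psi>
    by (simp add: L2_norm_def T)
  then have "\<exists>C. \<forall>\<psi>. L2_norm M (T \<psi>) \<le> C * norm \<psi>"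
    by blast
  ultimately show "admissible M \<pi> \<eta>"
    unfolding admissible_def bounded_into_L2_def is_L2_adjoint_def T_def[symmetric]
    using T(1) S by (auto simp: fun_eq_iff intro!: exI[of _ S])
qed

section \<open>Coefficients of unitary representations\<close>

locale haar_representation = haar_group \<mu> \<delta>
  for \<mu> :: "'g::{topological_group_add, t2_space} measure" and \<delta> :: "'g \<Rightarrow> real" +
  fixes \<pi> :: "'g \<Rightarrow> 'h::chilbert_space \<Rightarrow> 'h"
  assumes rep: "unitary_representation \<pi>"
begin

section \<open>Covariance and symmetry of coefficient functions\<close>

lemma rep_unitary: "unitary_operator (\<pi> s)"
  and rep_add: "\<pi> (s + t) x = \<pi> s (\<pi> t x)"
  and rep_continuous: "continuous_on UNIV (\<lambda>s. \<pi> s x)"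
  using rep unfolding unitary_representation_def by simp_all

lemma rep_cinner: "cinner (\<pi> s x) (\<pi> s y) = cinner x y"
  using rep_unitary[of s] unfolding unitary_operator_def by simp

text \<open>\<open>\<pi> 0\<close> is idempotent and surjective.\<close>

lemma rep_zero: "\<pi> 0 x = x"
proof -
  obtain y where "x = \<pi> 0 y"
    using rep_unitary[of 0] unfolding unitary_operator_def by blast
  then show ?thesis
    using rep_add[of 0 0 y] by simp
qed

lemma cinner_rep_shift: "cinner (\<pi> t x) (\<pi> s y) = cinner x (\<pi> (- t + s) y)"
  using rep_cinner[of t x "\<pi> (- t + s) y"] by (simp add: rep_add[symmetric] add.assoc[symmetric])

lemma coeff_op_rep: "coeff_op \<pi> \<eta> (\<pi> t x) s = coeff_op \<pi> \<eta> x (- t + s)"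
  by (simp add: coeff_op_def cinner_rep_shift)

lemma coeff_op_continuous: "continuous_on UNIV (coeff_op \<pi> \<eta> x)"
  unfolding coeff_op_def by (intro cinner.continuous_on continuous_on_const rep_continuous)

lemma coeff_op_measurable [measurable]: "coeff_op \<pi> \<eta> x \<in> borel_measurable borel"
  by (intro borel_measurable_continuous_onI coeff_op_continuous)

lemma coeff_op_L2_iff:
  "coeff_op \<pi> \<eta> x \<in> L2 \<mu> \<longleftrightarrow> (\<integral>\<^sup>+ s. ennreal ((cmod (coeff_op \<pi> \<eta> x s))\<^sup>2) \<partial>\<mu>) < \<infinity>"
proof -
  have "coeff_op \<pi> \<eta> x \<in> borel_measurable \<mu>"
    by measurable
  moreover have "(\<lambda>s. (cmod (coeff_op \<pi> \<eta> x s))\<^sup>2) \<in> borel_measurable \<mu>"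
    by measurable
  ultimately show ?thesis
    by (simp add: L2_def integrable_iff_bounded)
qed

text \<open>Conjugate symmetry together with unitarity moves \<open>\<pi> (- s)\<close> to the other
  argument, so the involution interchanges the two vectors.\<close>

lemma flat_coeff_op: "flat (coeff_op \<pi> \<eta> \<xi>) = coeff_op \<pi> \<xi> \<eta>"
proof
  fix s
  have "flat (coeff_op \<pi> \<eta> \<xi>) s = cinner (\<pi> (- s) \<eta>) \<xi>"
    unfolding flat_def coeff_op_def by (subst cinner_commute) simp
  also have "\<dots> = cinner (\<pi> (- s) \<eta>) (\<pi> 0 \<xi>)"
    by (simp add: rep_zero)
  also have "\<dots> = coeff_op \<pi> \<xi> \<eta> s"
    unfolding cinner_rep_shift by (simp add: coeff_op_def)
  finally show "flat (coeff_op \<pi> \<eta> \<xi>) s = coeff_op \<pi> \<xi> \<eta> s" .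
qed

text \<open>The factor at \<open>- t + u\<close> is the conjugate of a translated coefficient, so
  the two integrands agree pointwise. This turns the convolution equation into a statement about
  inner products.\<close>

lemma convolution_flat_coeff_op:
  "convolution \<mu> (flat (coeff_op \<pi> \<eta> \<xi>)) (coeff_op \<pi> \<eta> \<xi>) u
    = L2_inner \<mu> (coeff_op \<pi> \<xi> \<eta>) (coeff_op \<pi> \<xi> (\<pi> u \<eta>))"
proof -
  have "coeff_op \<pi> \<eta> \<xi> (- t + u) = cnj (coeff_op \<pi> \<xi> (\<pi> u \<eta>) t)" for t
    unfolding coeff_op_def cinner_rep_shift[symmetric] by (rule cinner_commute)
  then show ?thesis
    by (simp add: convolution_def L2_inner_def flat_coeff_op)
qed

text \<open>Inversion replaces the weighted integral by that of the squared modulus at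
  \<open>- s\<close>, which equals the squared modulus of
  \<open>coeff_op \<pi> \<xi> \<eta> s\<close>.\<close>

lemma flat_domain_iff:
  assumes "coeff_op \<pi> \<eta> \<xi> \<in> L2 \<mu>"
  shows "coeff_op \<pi> \<eta> \<xi> \<in> flat_domain \<mu> \<delta> \<longleftrightarrow> coeff_op \<pi> \<xi> \<eta> \<in> L2 \<mu>"
proof -
  have "(\<integral>\<^sup>+ s. ennreal (inverse (\<delta> s) * (cmod (coeff_op \<pi> \<eta> \<xi> s))\<^sup>2) \<partial>\<mu>)
      = (\<integral>\<^sup>+ s. ennreal ((cmod (coeff_op \<pi> \<eta> \<xi> (- s)))\<^sup>2) \<partial>\<mu>)"
    by (rule nn_integral_inverse[symmetric]) (auto intro!: continuous_intros coeff_op_continuous)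
  also have "(\<lambda>s. cmod (coeff_op \<pi> \<eta> \<xi> (- s))) = (\<lambda>s. cmod (coeff_op \<pi> \<xi> \<eta> s))"
    unfolding flat_coeff_op[of \<eta> \<xi>, symmetric] by (simp add: flat_def)
  then have "(\<integral>\<^sup>+ s. ennreal ((cmod (coeff_op \<pi> \<eta> \<xi> (- s)))\<^sup>2) \<partial>\<mu>)
      = (\<integral>\<^sup>+ s. ennreal ((cmod (coeff_op \<pi> \<xi> \<eta> s))\<^sup>2) \<partial>\<mu>)"
    by metis
  finally show ?thesis
    using assms by (simp add: flat_domain_def coeff_op_L2_iff)
qed

text \<open>Translating a vector translates its coefficient function from the left, and Haar measure
  is invariant under the common translation by \<open>- s\<close>.\<close>

lemma L2_inner_coeff_op_rep:
  "L2_inner \<mu> (coeff_op \<pi> \<eta> (\<pi> s x)) (coeff_op \<pi> \<eta> (\<pi> t y))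
    = L2_inner \<mu> (coeff_op \<pi> \<eta> x) (coeff_op \<pi> \<eta> (\<pi> (- s + t) y))"
proof -
  define f where "f = (\<lambda>u. coeff_op \<pi> \<eta> x u * cnj (coeff_op \<pi> \<eta> (\<pi> (- s + t) y) u))"
  have "continuous_on UNIV f"
    unfolding f_def by (intro continuous_intros coeff_op_continuous)
  then have [measurable]: "f \<in> borel_measurable borel"
    by (rule borel_measurable_continuous_onI)
  have "L2_inner \<mu> (coeff_op \<pi> \<eta> (\<pi> s x)) (coeff_op \<pi> \<eta> (\<pi> t y)) = (\<integral>u. f (- s + u) \<partial>\<mu>)"
    by (simp add: L2_inner_def f_def coeff_op_rep minus_add add.assoc[symmetric])
  also have "\<dots> = (\<integral>u. f u \<partial>distr \<mu> borel (\<lambda>u. - s + u))"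
    by (rule integral_distr[symmetric]) measurable
  finally show ?thesis
    by (simp add: distr_left L2_inner_def f_def)
qed

lemma L2_coeff_op_rep:
  assumes "coeff_op \<pi> \<eta> x \<in> L2 \<mu>"
  shows "coeff_op \<pi> \<eta> (\<pi> s x) \<in> L2 \<mu>"
  using assms nn_integral_left[of "\<lambda>u. ennreal ((cmod (coeff_op \<pi> \<eta> x u))\<^sup>2)" "- s"]
  by (simp add: coeff_op_L2_iff coeff_op_rep)

section \<open>Density of the orbit and extension of the isometry\<close>

text \<open>\<open>span\<close> is the real span, so complex multiples are put into the generating
  set; \<open>span (orbit \<eta>)\<close> is then the complex linear span of the translates of
  \<open>\<eta>\<close>.\<close>

definition orbit :: "'h \<Rightarrow> 'h set" where
  "orbit \<eta> = {c *\<^sub>C \<pi> s \<eta> | c s. True}"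

text \<open>If \<open>p\<close> is the projection of \<open>x\<close> onto the closure, then
  \<open>p - x\<close> is orthogonal to all \<open>\<pi> s \<eta>\<close>. Its coefficient function
  vanishes, and so does \<open>p - x\<close> by isometry.\<close>

lemma closure_span_orbit:
  assumes "admissible \<mu> \<pi> \<eta>"
  shows "closure (span (orbit \<eta>)) = UNIV"
proof -
  have "x \<in> closure (span (orbit \<eta>))" for x
  proof -
    obtain p where p: "p \<in> closure (span (orbit \<eta>))"
      "\<And>v. v \<in> span (orbit \<eta>) \<Longrightarrow> Re (cinner p v) = Re (cinner x v)"
      using riesz_subspace[OF subspace_span bounded_linear_compose[OF bounded_linear_Re cinner.bounded_linear_right]]
      by (metis (no_types, lifting))
    have "coeff_op \<pi> \<eta> (p - x) s = 0" for s
    proof -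
      \<comment> \<open>Only real parts are known to vanish; the multiplier \<open>z\<close> makes
        the real part equal to the squared modulus of \<open>z\<close>.\<close>
      define z where "z = coeff_op \<pi> \<eta> (p - x) s"
      have "z *\<^sub>C \<pi> s \<eta> \<in> span (orbit \<eta>)"
        by (intro span_base) (auto simp: orbit_def)
      then have "Re (cinner (p - x) (z *\<^sub>C \<pi> s \<eta>)) = 0"
        by (simp add: p cinner_diff_left)
      then have "Re (cnj z * z) = 0"
        by (simp add: cinner_scaleC_right z_def coeff_op_def)
      then show ?thesis
        by (simp add: z_def[symmetric] complex_eq_iff power2_eq_square[symmetric] sum_power2_eq_zero_iff)
    qed
    moreover have "(norm (p - x))\<^sup>2 = (\<integral>s. (cmod (coeff_op \<pi> \<eta> (p - x) s))\<^sup>2 \<partial>\<mu>)"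
      using assms by (simp add: admissible_iff_isometric isometric_into_L2_def)
    ultimately have "(norm (p - x))\<^sup>2 = 0"
      by simp
    then show ?thesis
      using p(1) by simp
  qed
  then show ?thesis
    by blast
qed

text \<open>Fatou's lemma along sequences in \<open>D\<close> gives square-integrability and
  \<open>\<le>\<close> everywhere. The reverse inequality then comes from the parallelogram law for
  the integral \<open>E\<close>.\<close>

lemma isometric_extension:
  assumes dense: "closure D = UNIV"
    and D: "\<And>x. x \<in> D \<Longrightarrow> coeff_op \<pi> \<xi> x \<in> L2 \<mu>"
    "\<And>x. x \<in> D \<Longrightarrow> (\<integral>s. (cmod (coeff_op \<pi> \<xi> x s))\<^sup>2 \<partial>\<mu>) = (norm x)\<^sup>2"
  shows "isometric_into_L2 \<mu> (coeff_op \<pi> \<xi>)"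
proof -
  have le: "(\<integral>\<^sup>+ s. ennreal ((cmod (coeff_op \<pi> \<xi> x s))\<^sup>2) \<partial>\<mu>) \<le> ennreal ((norm x)\<^sup>2)" for x
  proof -
    obtain y where y: "\<And>n. y n \<in> D" "y \<longlonglongrightarrow> x"
      using dense closure_sequential[of x D] by auto
    have "(\<lambda>n. coeff_op \<pi> \<xi> (y n) s) \<longlonglongrightarrow> coeff_op \<pi> \<xi> x s" for s
      unfolding coeff_op_def by (intro cinner.tendsto tendsto_const y)
    then have lim: "(\<lambda>n. ennreal ((cmod (coeff_op \<pi> \<xi> (y n) s))\<^sup>2)) \<longlonglongrightarrow> ennreal ((cmod (coeff_op \<pi> \<xi> x s))\<^sup>2)" for s
      by (intro tendsto_ennrealI tendsto_intros)
    have "(\<integral>\<^sup>+ s. ennreal ((cmod (coeff_op \<pi> \<xi> x s))\<^sup>2) \<partial>\<mu>)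
        = (\<integral>\<^sup>+ s. liminf (\<lambda>n. ennreal ((cmod (coeff_op \<pi> \<xi> (y n) s))\<^sup>2)) \<partial>\<mu>)"
      by (intro nn_integral_cong lim_imp_Liminf[symmetric] lim) simp
    also have "\<dots> \<le> liminf (\<lambda>n. \<integral>\<^sup>+ s. ennreal ((cmod (coeff_op \<pi> \<xi> (y n) s))\<^sup>2) \<partial>\<mu>)"
      by (intro nn_integral_liminf) measurable
    also have "(\<lambda>n. \<integral>\<^sup>+ s. ennreal ((cmod (coeff_op \<pi> \<xi> (y n) s))\<^sup>2) \<partial>\<mu>) = (\<lambda>n. ennreal ((norm (y n))\<^sup>2))"
      using D(1)[OF y(1)] D(2)[OF y(1)] by (simp add: nn_integral_eq_integral L2_def)
    also have "liminf (\<lambda>n. ennreal ((norm (y n))\<^sup>2)) = ennreal ((norm x)\<^sup>2)"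
      by (intro lim_imp_Liminf tendsto_ennrealI tendsto_intros y) simp
    finally show ?thesis .
  qed
  have L2: "coeff_op \<pi> \<xi> x \<in> L2 \<mu>" for x
    unfolding coeff_op_L2_iff using le[of x] by (rule le_less_trans) simp
  define E where "E = (\<lambda>x. \<integral>s. (cmod (coeff_op \<pi> \<xi> x s))\<^sup>2 \<partial>\<mu>)"
  have E_le: "E x \<le> (norm x)\<^sup>2" for x
  proof -
    have "ennreal (E x) = (\<integral>\<^sup>+ s. ennreal ((cmod (coeff_op \<pi> \<xi> x s))\<^sup>2) \<partial>\<mu>)"
      unfolding E_def using L2[of x] by (subst nn_integral_eq_integral) (auto simp: L2_def)
    with le[of x] have "ennreal (E x) \<le> ennreal ((norm x)\<^sup>2)"
      by argo
    then show ?thesis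
      by (simp add: ennreal_le_iff)
  qed
  have E_parallelogram: "E (x + y) + E (x - y) = 2 * E x + 2 * E y" for x y
  proof -
    have "x - y = x + (- 1) *\<^sub>R y"
      by simp
    then have "coeff_op \<pi> \<xi> (x - y) = (\<lambda>s. coeff_op \<pi> \<xi> x s + - 1 * coeff_op \<pi> \<xi> y s)"
      by (simp add: coeff_op_diff)
    then show ?thesis
      using integral_cmod_add_squared[OF L2[of x] L2[of y]]
        integral_cmod_add_squared[OF L2[of x] L2_scale[OF L2[of y], of "- 1"]]
      unfolding E_def coeff_op_add L2_inner_scale_right by simp
  qed
  have "(norm x)\<^sup>2 \<le> E x" for x
  proof -
    obtain y where y: "\<And>n. y n \<in> D" "y \<longlonglongrightarrow> x"
      using dense closure_sequential[of x D] by auto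
    \<comment> \<open>Parallelogram law for \<open>y n\<close> and \<open>x - y n\<close>: the sum
      is \<open>x\<close>, the difference is controlled by \<open>E_le\<close>, and \<open>E\<close>
      is known at \<open>y n\<close>. In the limit the left side becomes the squared norm of
      \<open>x\<close>.\<close>
    have "2 * (norm (y n))\<^sup>2 - (norm (y n - (x - y n)))\<^sup>2 \<le> E x" for n
    proof -
      have "E (y n) = (norm (y n))\<^sup>2"
        unfolding E_def by (rule D(2)[OF y(1)])
      moreover have "0 \<le> E (x - y n)"
        by (simp add: E_def)
      ultimately show ?thesis
        using E_parallelogram[of "y n" "x - y n"] E_le[of "y n - (x - y n)"] by simp
    qed
    moreover have "(\<lambda>n. 2 * (norm (y n))\<^sup>2 - (norm (y n - (x - y n)))\<^sup>2) \<longlonglongrightarrow> 2 * (norm x)\<^sup>2 - (norm (x - (x - x)))\<^sup>2"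
      by (intro tendsto_intros y)
    ultimately have "2 * (norm x)\<^sup>2 - (norm (x - (x - x)))\<^sup>2 \<le> E x"
      by (intro LIMSEQ_le_const2) auto
    then show ?thesis
      by simp
  qed
  with E_le L2 show ?thesis
    unfolding isometric_into_L2_def E_def by (metis antisym)
qed

text \<open>A common translation reduces inner products of orbit vectors to \<open>orth\<close>;
  sesquilinearity extends the identity to the span one argument at a time, and density does the
  rest.\<close>

lemma isometric_from_orbit:
  assumes dense: "closure (span (orbit \<eta>)) = UNIV" and L2: "coeff_op \<pi> \<xi> \<eta> \<in> L2 \<mu>"
    and orth: "\<And>u. L2_inner \<mu> (coeff_op \<pi> \<xi> \<eta>) (coeff_op \<pi> \<xi> (\<pi> u \<eta>)) = cinner \<eta> (\<pi> u \<eta>)"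
  shows "isometric_into_L2 \<mu> (coeff_op \<pi> \<xi>)"
proof -
  let ?T = "coeff_op \<pi> \<xi>"
  have zero: "?T 0 = (\<lambda>s. 0)"
    by (simp add: coeff_op_def)
  have orb: "?T x \<in> L2 \<mu>" if "x \<in> orbit \<eta>" for x
    using that L2 by (auto simp: orbit_def coeff_op_scaleC intro!: L2_scale L2_coeff_op_rep)
  have orb_inner: "L2_inner \<mu> (?T x) (?T y) = cinner x y" if "x \<in> orbit \<eta>" "y \<in> orbit \<eta>" for x y
    using that by (auto simp: orbit_def coeff_op_scaleC L2_inner_scale_left L2_inner_scale_right
        L2_inner_coeff_op_rep orth cinner_scaleC_left cinner_scaleC_right cinner_rep_shift)
  \<comment> \<open>Membership in \<open>L2\<close> is carried through the induction, because
    additivity of the inner product is available for square-integrable functions.\<close>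
  have left: "?T x \<in> L2 \<mu> \<and> L2_inner \<mu> (?T x) (?T y) = cinner x y"
    if "x \<in> span (orbit \<eta>)" and y: "y \<in> orbit \<eta>" for x y
    using that(1)
  proof (induction rule: span_induct)
    case base
    show ?case
      using orb[OF y] by (auto intro!: subspaceI simp: zero coeff_op_add coeff_op_scaleR L2_add L2_scale
          L2_inner_add_left L2_inner_scale_left cinner_add_left cinner_scaleR_left)
        (auto simp: L2_def L2_inner_def)
  qed (use orb orb_inner y in auto)
  have L2_span: "?T x \<in> L2 \<mu>" if "x \<in> span (orbit \<eta>)" for x
    using left[OF that, of "1 *\<^sub>C \<pi> 0 \<eta>"] by (auto simp: orbit_def)
  have right: "?T y \<in> L2 \<mu> \<and> L2_inner \<mu> (?T x) (?T y) = cinner x y"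
    if "y \<in> span (orbit \<eta>)" and x: "x \<in> span (orbit \<eta>)" for x y
    using that(1)
  proof (induction rule: span_induct)
    case base
    show ?case
      using L2_span[OF x] by (auto intro!: subspaceI simp: zero coeff_op_add coeff_op_scaleR L2_add L2_scale
          L2_inner_add_right L2_inner_scale_right cinner_add_right cinner_scaleR_right)
        (auto simp: L2_def L2_inner_def)
  qed (use left orb x in auto)
  show ?thesis
  proof (rule isometric_extension[OF dense L2_span])
    fix x assume x: "x \<in> span (orbit \<eta>)"
    have "complex_of_real (\<integral>s. (cmod (?T x s))\<^sup>2 \<partial>\<mu>) = complex_of_real ((norm x)\<^sup>2)"
      using right[OF x x] unfolding L2_inner_self cinner_self by blast
    then show "(\<integral>s. (cmod (?T x s))\<^sup>2 \<partial>\<mu>) = (norm x)\<^sup>2"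
      by (simp only: of_real_eq_iff)
  qed
qed

section \<open>Equality of ranges\<close>

text \<open>By \<open>eq\<close> and covariance, \<open>\<pi> s \<eta>\<close> lies in the set
  \<open>R\<close> of vectors that \<open>coeff_op \<pi> \<xi>\<close> sends into the range of
  \<open>coeff_op \<pi> \<eta>\<close>. \<open>R\<close> is a subspace, and closed because both maps
  are isometric. Exchanging the roles of the vectors gives the other inclusion.\<close>

lemma range_coeff_op_subset:
  assumes \<eta>: "admissible \<mu> \<pi> \<eta>" and \<xi>: "admissible \<mu> \<pi> \<xi>"
    and eq: "coeff_op \<pi> \<xi> \<eta> = coeff_op \<pi> \<eta> \<xi>"
  shows "range (coeff_op \<pi> \<xi>) \<subseteq> range (coeff_op \<pi> \<eta>)"
proof -
  have iso: "(norm x)\<^sup>2 = (\<integral>s. (cmod (coeff_op \<pi> \<eta> x s))\<^sup>2 \<partial>\<mu>)"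
    "(norm x)\<^sup>2 = (\<integral>s. (cmod (coeff_op \<pi> \<xi> x s))\<^sup>2 \<partial>\<mu>)" for x
    using \<eta> \<xi> by (simp_all add: admissible_iff_isometric isometric_into_L2_def)
  define R where "R = {x. \<exists>y. coeff_op \<pi> \<eta> y = coeff_op \<pi> \<xi> x}"
  have "orbit \<eta> \<subseteq> R"
  proof
    fix x assume "x \<in> orbit \<eta>"
    then obtain c s where x: "x = c *\<^sub>C \<pi> s \<eta>"
      by (auto simp: orbit_def)
    have "coeff_op \<pi> \<eta> (c *\<^sub>C \<pi> s \<xi>) = coeff_op \<pi> \<xi> x"
      by (simp add: x coeff_op_scaleC coeff_op_rep eq)
    then show "x \<in> R"
      unfolding R_def by blast
  qed
  moreover have "subspace R"
  proof (rule subspaceI)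
    have "coeff_op \<pi> \<eta> 0 = coeff_op \<pi> \<xi> 0"
      by (simp add: coeff_op_def)
    then show "0 \<in> R"
      unfolding R_def by blast
    show "x + y \<in> R" if "x \<in> R" "y \<in> R" for x y
    proof -
      from that obtain a b where "coeff_op \<pi> \<eta> a = coeff_op \<pi> \<xi> x" "coeff_op \<pi> \<eta> b = coeff_op \<pi> \<xi> y"
        unfolding R_def by blast
      then have "coeff_op \<pi> \<eta> (a + b) = coeff_op \<pi> \<xi> (x + y)"
        by (simp add: coeff_op_add)
      then show ?thesis
        unfolding R_def by blast
    qed
    show "c *\<^sub>R x \<in> R" if "x \<in> R" for c x
    proof -
      from that obtain a where "coeff_op \<pi> \<eta> a = coeff_op \<pi> \<xi> x"
        unfolding R_def by blast
      then have "coeff_op \<pi> \<eta> (c *\<^sub>R a) = coeff_op \<pi> \<xi> (c *\<^sub>R x)"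
        by (simp add: coeff_op_scaleR)
      then show ?thesis
        unfolding R_def by blast
    qed
  qed
  ultimately have span: "span (orbit \<eta>) \<subseteq> R"
    by (rule span_minimal)
  have "x \<in> R" for x
  proof -
    obtain y where y: "\<And>n. y n \<in> R" "y \<longlonglongrightarrow> x"
      using closure_span_orbit[OF \<eta>] closure_mono[OF span] closure_sequential[of x R] by blast
    then obtain z where z: "\<And>n. coeff_op \<pi> \<eta> (z n) = coeff_op \<pi> \<xi> (y n)"
      unfolding R_def mem_Collect_eq by metis
    have "(norm (z i - z j))\<^sup>2 = (norm (y i - y j))\<^sup>2" for i j
      unfolding iso(1)[of "z i - z j"] iso(2)[of "y i - y j"] coeff_op_diff z ..
    then have "norm (z i - z j) = norm (y i - y j)" for i j
      by (simp add: power2_eq_iff_nonneg)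
    moreover have "Cauchy y"
      using y(2) LIMSEQ_imp_Cauchy by blast
    ultimately have "Cauchy z"
      by (simp add: Cauchy_def dist_norm)
    then obtain p where p: "z \<longlonglongrightarrow> p"
      using Cauchy_convergent convergent_def by blast
    \<comment> \<open>The value at each \<open>s\<close> depends continuously on the vector, so the
      limits are compared pointwise; elements of the ranges are functions, not classes modulo null
      sets.\<close>
    have "coeff_op \<pi> \<eta> p s = coeff_op \<pi> \<xi> x s" for s
    proof (rule LIMSEQ_unique)
      show "(\<lambda>n. coeff_op \<pi> \<eta> (z n) s) \<longlonglongrightarrow> coeff_op \<pi> \<eta> p s"
        unfolding coeff_op_def by (intro cinner.tendsto tendsto_const p)
      show "(\<lambda>n. coeff_op \<pi> \<eta> (z n) s) \<longlonglongrightarrow> coeff_op \<pi> \<xi> x s"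
        unfolding z unfolding coeff_op_def by (intro cinner.tendsto tendsto_const y)
    qed
    then have "coeff_op \<pi> \<eta> p = coeff_op \<pi> \<xi> x" ..
    then show "x \<in> R"
      unfolding R_def by blast
  qed
  then have "\<exists>y. coeff_op \<pi> \<eta> y = coeff_op \<pi> \<xi> x" for x
    unfolding R_def by blast
  then show ?thesis
    by (metis image_subsetI rangeI)
qed

end

theorem proposition7:
  fixes \<mu> :: "'g::{topological_group_add, t2_space} measure"
    and \<delta> :: "'g \<Rightarrow> real"
    and \<pi> :: "'g \<Rightarrow> 'h::chilbert_space \<Rightarrow> 'h"
    and \<eta> \<xi> :: 'h
  assumes "locally_compact_space (euclidean :: 'g topology)"
    and "left_haar_measure \<mu>"
    and "modular_function \<mu> \<delta>"
    and "unitary_representation \<pi>"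
    and "admissible \<mu> \<pi> \<eta>"
  defines "g_\<eta> \<equiv> coeff_op \<pi> \<eta> \<eta>"
    and "\<xi>_\<eta> \<equiv> coeff_op \<pi> \<eta> \<xi>"
  shows "(admissible \<mu> \<pi> \<xi> \<longleftrightarrow>
           \<xi>_\<eta> \<in> flat_domain \<mu> \<delta> \<and> g_\<eta> = convolution \<mu> (flat \<xi>_\<eta>) \<xi>_\<eta>) \<and>
         (admissible \<mu> \<pi> \<xi> \<and> flat \<xi>_\<eta> = \<xi>_\<eta> \<longrightarrow>
           (\<lambda>s. cinner \<eta> (\<pi> s \<eta>)) = (\<lambda>s. cinner \<xi> (\<pi> s \<xi>)) \<and>
           range (coeff_op \<pi> \<xi>) = range (coeff_op \<pi> \<eta>))"
proof -
  interpret haar_representation \<mu> \<delta> \<pi>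
    by unfold_locales (fact assms)+
  have \<eta>_iso: "isometric_into_L2 \<mu> (coeff_op \<pi> \<eta>)"
    using assms(5) by (simp add: admissible_iff_isometric)
  then have "coeff_op \<pi> \<eta> \<xi> \<in> L2 \<mu>"
    by (simp add: isometric_into_L2_def)
  note flat_iff = flat_domain_iff[OF this]
  have conv_iff: "g_\<eta> = convolution \<mu> (flat \<xi>_\<eta>) \<xi>_\<eta> \<longleftrightarrow>
      (\<forall>u. L2_inner \<mu> (coeff_op \<pi> \<xi> \<eta>) (coeff_op \<pi> \<xi> (\<pi> u \<eta>)) = cinner \<eta> (\<pi> u \<eta>))"
    unfolding g_\<eta>_def \<xi>_\<eta>_def fun_eq_iff convolution_flat_coeff_op coeff_op_def[of \<pi> \<eta> \<eta>]
    by (intro iff_allI eq_commute)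
  \<comment> \<open>From left to right, the identity is preservation of the inner product of
    \<open>\<eta>\<close> and \<open>\<pi> u \<eta>\<close>; from right to left,
    \<open>isometric_from_orbit\<close> applies.\<close>
  have part1: "admissible \<mu> \<pi> \<xi> \<longleftrightarrow> \<xi>_\<eta> \<in> flat_domain \<mu> \<delta> \<and> g_\<eta> = convolution \<mu> (flat \<xi>_\<eta>) \<xi>_\<eta>"
    unfolding conv_iff unfolding \<xi>_\<eta>_def flat_iff admissible_iff_isometric
    using isometric_into_L2_inner[of \<mu> \<pi> \<xi>] isometric_from_orbit[OF closure_span_orbit[OF assms(5)], of \<xi>]
    by (auto simp: isometric_into_L2_def)
  have part2: "(\<lambda>s. cinner \<eta> (\<pi> s \<eta>)) = (\<lambda>s. cinner \<xi> (\<pi> s \<xi>)) \<and>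
      range (coeff_op \<pi> \<xi>) = range (coeff_op \<pi> \<eta>)" if \<xi>: "admissible \<mu> \<pi> \<xi>" and "flat \<xi>_\<eta> = \<xi>_\<eta>"
  proof -
    have eq: "coeff_op \<pi> \<xi> \<eta> = coeff_op \<pi> \<eta> \<xi>"
      using that(2) by (simp add: \<xi>_\<eta>_def flat_coeff_op)
    have "cinner \<eta> (\<pi> s \<eta>) = cinner \<xi> (\<pi> s \<xi>)" for s
    proof -
      \<comment> \<open>This common function, paired in \<open>L2\<close> with
        \<open>coeff_op \<pi> \<xi> \<eta> = coeff_op \<pi> \<eta> \<xi>\<close>, yields one
        coefficient through each of the two isometries.\<close>
      have "coeff_op \<pi> \<xi> (\<pi> s \<eta>) = coeff_op \<pi> \<eta> (\<pi> s \<xi>)"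
        by (simp add: fun_eq_iff coeff_op_rep eq)
      then show ?thesis
        using isometric_into_L2_inner[OF \<eta>_iso, of \<xi> "\<pi> s \<xi>"]
          isometric_into_L2_inner[OF \<xi>[unfolded admissible_iff_isometric], of \<eta> "\<pi> s \<eta>"]
        by (simp add: eq)
    qed
    then show ?thesis
      using range_coeff_op_subset[OF assms(5) \<xi> eq] range_coeff_op_subset[OF \<xi> assms(5) eq[symmetric]]
      by blast
  qed
  from part1 part2 show ?thesis
    by blast
qed

end
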